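(* Let $\Omega\subset\mathbb{R}^n$ be a smooth bounded domain, $0<s<1$, and let $c,\gamma>0$ be fixed constants. Then for some $\lambda>0$ there exists a solution $u\in\mathbb{H}^s(\Omega)$ of $$(-\Delta)^s u=\lambda\,(u-\gamma)_+\ \text{ in }\Omega,\qquad u=0\ \text{ on }\partial\Omega,$$ with $\int_\Omega (u-\gamma)_+^2=c$.
   Context: $(-\Delta)^s$ is the spectral fractional Laplacian: if $0<\lambda_1<\lambda_2\le\dots$ and $\{\phi_k\}$ are the eigenvalues and $L^2(\Omega)$-orthonormal eigenfunctions of the Dirichlet Laplacian $-\Delta$ on $\Omega$, and $f=\sum_k a_k\phi_k$, then $(-\Delta)^s f=\sum_k\lambda_k^s a_k\phi_k$. The energy space is $\mathbb{H}^s(\Omega)=\{f=\sum_k a_k\phi_k\in L^2(\Omega):\sum_k\lambda_k^s a_k^2<\infty\}$; the zero boundary condition is encoded in the spectral definition, and the equation is understood in the sense that the expansion coefficients of both sides in $\{\phi_k\}$ agree. $t_+=\max(t,0)$. *)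

theory Defs
  imports "HOL-Analysis.Analysis"
begin

definition partial_deriv :: "'n::finite \<Rightarrow> (real^'n \<Rightarrow> real) \<Rightarrow> real^'n \<Rightarrow> real" where
  "partial_deriv i f x = frechet_derivative f (at x) (axis i 1)"

definition grad :: "(real^'n \<Rightarrow> real) \<Rightarrow> real^'n \<Rightarrow> real^'n::finite" where
  "grad f x = (\<chi> i. partial_deriv i f x)"

(* Only meaningful for open S: the derivatives are the full ones, "at x". *)
fun Ck_on :: "nat \<Rightarrow> (real^'n) set \<Rightarrow> (real^'n::finite \<Rightarrow> real) \<Rightarrow> bool" where
  "Ck_on 0 S f \<longleftrightarrow> continuous_on S f"
| "Ck_on (Suc k) S f \<longleftrightarrow>
     (\<forall>x\<in>S. f differentiable (at x)) \<and> (\<forall>i. Ck_on k S (partial_deriv i f))"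

definition smooth_on :: "(real^'n) set \<Rightarrow> (real^'n::finite \<Rightarrow> real) \<Rightarrow> bool" where
  "smooth_on S f \<longleftrightarrow> (\<forall>k. Ck_on k S f)"

(* The boundary is smooth in the sense that, near each of its points, the domain is a
   sublevel set of a smooth function with nonvanishing gradient; the domain then lies
   locally on one side of its boundary, which is the zero set of that function. *)
definition smooth_bounded_domain :: "(real^'n::finite) set \<Rightarrow> bool" where
  "smooth_bounded_domain \<Omega> \<longleftrightarrow>
     open \<Omega> \<and> connected \<Omega> \<and> \<Omega> \<noteq> {} \<and> bounded \<Omega> \<and>
     (\<forall>p\<in>frontier \<Omega>. \<exists>U \<rho>. open U \<and> p \<in> U \<and> smooth_on U \<rho> \<and>
        (\<forall>x\<in>U. grad \<rho> x \<noteq> 0) \<and> \<Omega> \<inter> U = {x\<in>U. \<rho> x < 0})"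

(* Elements of L^2 are represented by functions on the whole space; only their values
   on \<Omega>, up to null sets, matter. *)
definition L2 :: "(real^'n::finite) set \<Rightarrow> (real^'n \<Rightarrow> real) set" where
  "L2 \<Omega> = {f. f \<in> borel_measurable (lebesgue_on \<Omega>) \<and>
              integrable (lebesgue_on \<Omega>) (\<lambda>x. (f x)\<^sup>2)}"

definition L2_inner ::
    "(real^'n::finite) set \<Rightarrow> (real^'n \<Rightarrow> real) \<Rightarrow> (real^'n \<Rightarrow> real) \<Rightarrow> real" where
  "L2_inner \<Omega> f g = (LINT x|lebesgue_on \<Omega>. f x * g x)"

definition test_function :: "(real^'n::finite) set \<Rightarrow> (real^'n \<Rightarrow> real) \<Rightarrow> bool" where
  "test_function \<Omega> \<psi> \<longleftrightarrow>
     smooth_on UNIV \<psi> \<and> compact (closure {x. \<psi> x \<noteq> 0}) \<and> closure {x. \<psi> x \<noteq> 0} \<subseteq> \<Omega>"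

(* f belongs to H^1_0(\<Omega>), the H^1-closure of the test functions, and has weak gradient G:
   the limit G of the gradients is the weak gradient of f, determined up to null sets. *)
definition H10_with_gradient ::
    "(real^'n::finite) set \<Rightarrow> (real^'n \<Rightarrow> real) \<Rightarrow> (real^'n \<Rightarrow> real^'n) \<Rightarrow> bool" where
  "H10_with_gradient \<Omega> f G \<longleftrightarrow>
     f \<in> L2 \<Omega> \<and> (\<forall>i. (\<lambda>x. G x $ i) \<in> L2 \<Omega>) \<and>
     (\<exists>\<psi>. (\<forall>j. test_function \<Omega> (\<psi> j)) \<and>
       (\<lambda>j. LINT x|lebesgue_on \<Omega>. (\<psi> j x - f x)\<^sup>2) \<longlonglongrightarrow> 0 \<and>
       (\<lambda>j. LINT x|lebesgue_on \<Omega>. (norm (grad (\<psi> j) x - G x))\<^sup>2) \<longlonglongrightarrow> 0)"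

(* f is a nonzero weak solution of -\<Delta>f = \<mu>f with f in H^1_0(\<Omega>). *)
definition dirichlet_eigenfunction ::
    "(real^'n::finite) set \<Rightarrow> real \<Rightarrow> (real^'n \<Rightarrow> real) \<Rightarrow> bool" where
  "dirichlet_eigenfunction \<Omega> \<mu> f \<longleftrightarrow>
     \<not> (AE x in lebesgue_on \<Omega>. f x = 0) \<and>
     (\<exists>G. H10_with_gradient \<Omega> f G \<and>
        (\<forall>\<psi>. test_function \<Omega> \<psi> \<longrightarrow>
          (LINT x|lebesgue_on \<Omega>. G x \<bullet> grad \<psi> x) = \<mu> * L2_inner \<Omega> f \<psi>))"

definition eigen_coeff :: "(real^'n::finite) set \<Rightarrow> (nat \<Rightarrow> real^'n \<Rightarrow> real) \<Rightarrow>
    (real^'n \<Rightarrow> real) \<Rightarrow> nat \<Rightarrow> real" where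
  "eigen_coeff \<Omega> \<phi> f k = L2_inner \<Omega> f (\<phi> k)"

(* Indexing starts at 0, so ev 0 is \<lambda>\<^sub>1. The last conjunct says that every f in L^2(\<Omega>) is the
   L^2-limit of its expansion; hence ev lists all Dirichlet eigenvalues with multiplicity. *)
definition dirichlet_eigensystem ::
    "(real^'n::finite) set \<Rightarrow> (nat \<Rightarrow> real) \<Rightarrow> (nat \<Rightarrow> real^'n \<Rightarrow> real) \<Rightarrow> bool" where
  "dirichlet_eigensystem \<Omega> ev \<phi> \<longleftrightarrow>
     0 < ev 0 \<and> ev 0 < ev 1 \<and> incseq ev \<and>
     (\<forall>k. dirichlet_eigenfunction \<Omega> (ev k) (\<phi> k)) \<and>
     (\<forall>j k. L2_inner \<Omega> (\<phi> j) (\<phi> k) = (if j = k then 1 else 0)) \<and>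
     (\<forall>f\<in>L2 \<Omega>. (\<lambda>N. LINT x|lebesgue_on \<Omega>. (f x - (\<Sum>k<N. eigen_coeff \<Omega> \<phi> f k * \<phi> k x))\<^sup>2)
        \<longlonglongrightarrow> 0)"

definition energy_space :: "(real^'n::finite) set \<Rightarrow> (nat \<Rightarrow> real) \<Rightarrow>
    (nat \<Rightarrow> real^'n \<Rightarrow> real) \<Rightarrow> real \<Rightarrow> (real^'n \<Rightarrow> real) set" where
  "energy_space \<Omega> ev \<phi> s =
     {f \<in> L2 \<Omega>. summable (\<lambda>k. ev k powr s * (eigen_coeff \<Omega> \<phi> f k)\<^sup>2)}"

(* For f in the energy space of order s the image need not be a function in L^2(\<Omega>): it is the
   formal series \<Sum>\<^sub>k \<lambda>\<^sub>k^s a\<^sub>k \<phi>\<^sub>k, represented by the sequence of its coefficients. *)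
definition spectral_frac_laplacian :: "(real^'n::finite) set \<Rightarrow> (nat \<Rightarrow> real) \<Rightarrow>
    (nat \<Rightarrow> real^'n \<Rightarrow> real) \<Rightarrow> real \<Rightarrow> (real^'n \<Rightarrow> real) \<Rightarrow> (nat \<Rightarrow> real)" where
  "spectral_frac_laplacian \<Omega> ev \<phi> s f = (\<lambda>k. ev k powr s * eigen_coeff \<Omega> \<phi> f k)"

definition pos_part :: "real \<Rightarrow> real" where
  "pos_part t = max t 0"

end

theory Submission
  imports Defs "HOL-Complex_Analysis.Great_Picard"
begin

text \<open>
  Minimise the energy \<open>E u = \<Sum>\<^sub>k \<lambda>\<^sub>k^s u\<^sub>k\<^sup>2\<close> over all \<open>u\<close> in the energy space with
  \<open>F u = \<integral> (u - \<gamma>)\<^sub>+\<^sup>2 \<ge> c\<close>. A minimising sequence has bounded energy, and since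
  \<open>\<lambda>\<^sub>k \<rightarrow> \<infinity>\<close> it has a subsequence converging in \<open>L\<^sup>2\<close>, so a minimiser \<open>u\<close> exists; shrinking \<open>u\<close>
  shows \<open>F u = c\<close>. Put \<open>w = (u - \<gamma>)\<^sub>+\<close>. As \<open>F\<close> is convex with derivative \<open>2 w\<close> at \<open>u\<close>, every
  \<open>v\<close> with \<open>\<langle>w, v\<rangle> = \<langle>w, u\<rangle>\<close> is admissible, so \<open>u\<close> minimises \<open>E\<close> on this affine hyperplane
  and \<open>\<lambda>\<^sub>k^s u\<^sub>k = l w\<^sub>k\<close> for all \<open>k\<close>, with \<open>l = E u / \<langle>w, u\<rangle>\<close>.

  That \<open>\<lambda>\<^sub>k \<rightarrow> \<infinity>\<close> is not part of the definition of an eigensystem. If \<open>\<lambda>\<^sub>k \<le> C\<close> for all \<open>k\<close>, then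
  every \<open>f\<close> in \<open>L\<^sup>2\<close> would be a limit of \<open>C\<^sup>1\<close> functions \<open>\<psi>\<close> with
  \<open>\<integral> |\<nabla>\<psi>|\<^sup>2 \<le> C \<integral> f\<^sup>2 + o(1)\<close>, whence \<open>\<integral> (f(x + h) - f(x))\<^sup>2 \<le> C |h|\<^sup>2 \<integral> f\<^sup>2\<close>. This fails
  for the indicator function of a small ball of radius \<open>r\<close> and \<open>|h| = 2 r\<close>.
\<close>

subsection \<open>Square integrable functions\<close>

text \<open>The condition that defines \<open>L2\<close>, stated over an arbitrary measure so that
  the Hilbert space facts do not mention the domain.\<close>

definition sq_integrable :: "'a measure \<Rightarrow> ('a \<Rightarrow> real) \<Rightarrow> bool" where
  "sq_integrable M f \<longleftrightarrow> f \<in> borel_measurable M \<and> integrable M (\<lambda>x. (f x)\<^sup>2)"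

lemma sq_integrableI:
  "f \<in> borel_measurable M \<Longrightarrow> integrable M (\<lambda>x. (f x)\<^sup>2) \<Longrightarrow> sq_integrable M f"
  by (simp add: sq_integrable_def)

lemma sq_integrable_measurable: "sq_integrable M f \<Longrightarrow> f \<in> borel_measurable M"
  by (simp add: sq_integrable_def)

lemma sq_integrable_square: "sq_integrable M f \<Longrightarrow> integrable M (\<lambda>x. (f x)\<^sup>2)"
  by (simp add: sq_integrable_def)

lemma sq_integrable_mult:
  assumes "sq_integrable M f" "sq_integrable M g"
  shows "integrable M (\<lambda>x. f x * g x)"
proof (rule Bochner_Integration.integrable_bound)
  show "integrable M (\<lambda>x. (f x)\<^sup>2 + (g x)\<^sup>2)"
    using assms by (intro Bochner_Integration.integrable_add sq_integrable_square)
  show "(\<lambda>x. f x * g x) \<in> borel_measurable M"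
    using assms[THEN sq_integrable_measurable] by measurable
  show "AE x in M. norm (f x * g x) \<le> norm ((f x)\<^sup>2 + (g x)\<^sup>2)"
  proof (rule AE_I2)
    fix x
    have "0 \<le> (\<bar>f x\<bar> - \<bar>g x\<bar>)\<^sup>2" by simp
    hence "2 * (\<bar>f x\<bar> * \<bar>g x\<bar>) \<le> (f x)\<^sup>2 + (g x)\<^sup>2"
      by (simp add: power2_eq_square algebra_simps)
    moreover have "0 \<le> \<bar>f x\<bar> * \<bar>g x\<bar>" by simp
    ultimately have "\<bar>f x\<bar> * \<bar>g x\<bar> \<le> (f x)\<^sup>2 + (g x)\<^sup>2" by linarith
    then show "norm (f x * g x) \<le> norm ((f x)\<^sup>2 + (g x)\<^sup>2)"
      by (simp add: abs_mult)
  qed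
qed

lemma sq_integrable_cmult:
  "sq_integrable M f \<Longrightarrow> sq_integrable M (\<lambda>x. a * f x)"
  by (auto simp: sq_integrable_def power_mult_distrib)

lemma sq_integrable_add:
  assumes "sq_integrable M f" "sq_integrable M g"
  shows "sq_integrable M (\<lambda>x. f x + g x)"
proof (rule sq_integrableI)
  show "(\<lambda>x. f x + g x) \<in> borel_measurable M"
    using assms[THEN sq_integrable_measurable] by measurable
  show "integrable M (\<lambda>x. (f x + g x)\<^sup>2)"
    using assms sq_integrable_mult[OF assms]
    by (simp add: power2_sum sq_integrable_square mult.assoc)
qed

lemma sq_integrable_diff:
  assumes "sq_integrable M f" "sq_integrable M g"
  shows "sq_integrable M (\<lambda>x. f x - g x)"
  using sq_integrable_add[OF assms(1) sq_integrable_cmult[OF assms(2), of "-1"]] by simp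

lemma sq_integrable_zero: "sq_integrable M (\<lambda>x. 0)"
  by (simp add: sq_integrable_def)

lemma sq_integrable_sum:
  "(\<And>k. k \<in> K \<Longrightarrow> sq_integrable M (f k)) \<Longrightarrow> sq_integrable M (\<lambda>x. \<Sum>k\<in>K. f k x)"
  by (induction K rule: infinite_finite_induct) (auto intro: sq_integrable_add sq_integrable_zero)

lemma sq_integrable_bound:
  assumes "sq_integrable M g" "f \<in> borel_measurable M" "\<And>x. \<bar>f x\<bar> \<le> \<bar>g x\<bar>"
  shows "sq_integrable M f"
proof (rule sq_integrableI[OF assms(2)])
  show "integrable M (\<lambda>x. (f x)\<^sup>2)"
    using assms by (intro Bochner_Integration.integrable_bound[OF sq_integrable_square[OF assms(1)]])
      (auto intro!: AE_I2 simp: abs_le_square_iff)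
qed

section \<open>Squares of sums and the Cauchy-Schwarz inequality\<close>

lemma integral_square_add:
  assumes "sq_integrable M f" "sq_integrable M g"
  shows "(LINT x|M. (f x + g x)\<^sup>2) =
    (LINT x|M. (f x)\<^sup>2) + 2 * (LINT x|M. f x * g x) + (LINT x|M. (g x)\<^sup>2)"
proof -
  have "(LINT x|M. (f x + g x)\<^sup>2) = (LINT x|M. (f x)\<^sup>2 + 2 * (f x * g x) + (g x)\<^sup>2)"
    by (simp add: power2_sum algebra_simps)
  also have "\<dots> = (LINT x|M. (f x)\<^sup>2) + 2 * (LINT x|M. f x * g x) + (LINT x|M. (g x)\<^sup>2)"
    using assms sq_integrable_mult[OF assms] by (simp add: sq_integrable_square)
  finally show ?thesis .
qed

lemma integral_square_add_le:
  assumes "sq_integrable M f" "sq_integrable M g"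
  shows "(LINT x|M. (f x + g x)\<^sup>2) \<le> 2 * (LINT x|M. (f x)\<^sup>2) + 2 * (LINT x|M. (g x)\<^sup>2)"
proof -
  have "0 \<le> (LINT x|M. (f x + (-1) * g x)\<^sup>2)" by simp
  also have "\<dots> = (LINT x|M. (f x)\<^sup>2) - 2 * (LINT x|M. f x * g x) + (LINT x|M. (g x)\<^sup>2)"
    by (subst integral_square_add[OF assms(1) sq_integrable_cmult[OF assms(2)]]) simp
  finally show ?thesis
    by (simp add: integral_square_add[OF assms])
qed

text \<open>Cauchy-Schwarz by the discriminant: the integral of the square of \<open>f + t g\<close>
  is a polynomial in t of degree at most 2 that is never negative.\<close>

lemma integral_mult_square_le:
  assumes f: "sq_integrable M f" and g: "sq_integrable M g"
  shows "(LINT x|M. f x * g x)\<^sup>2 \<le> (LINT x|M. (f x)\<^sup>2) * (LINT x|M. (g x)\<^sup>2)"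
proof -
  define A B C where "A = (LINT x|M. (f x)\<^sup>2)" "B = (LINT x|M. f x * g x)" "C = (LINT x|M. (g x)\<^sup>2)"
  have quad: "0 \<le> A + 2 * t * B + t\<^sup>2 * C" for t
  proof -
    have "0 \<le> (LINT x|M. (f x + t * g x)\<^sup>2)" by simp
    also have "\<dots> = A + 2 * t * B + t\<^sup>2 * C"
      by (subst integral_square_add[OF f sq_integrable_cmult[OF g]])
        (simp add: A_B_C_def power_mult_distrib mult.left_commute mult.assoc)
    finally show ?thesis .
  qed
  have "0 \<le> C" by (simp add: A_B_C_def)
  show ?thesis
  proof (cases "C = 0")
    case True
    have "B = 0"
    proof (rule ccontr)
      assume "B \<noteq> 0"
      \<comment> \<open>For \<open>C = 0\<close> the polynomial is affine in t, and this t gives it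
        the value -1.\<close>
      with quad[of "-(A + 1) / (2 * B)"] True show False by (simp add: field_simps)
    qed
    then show ?thesis using True by (simp add: A_B_C_def)
  next
    case False
    with \<open>0 \<le> C\<close> have "0 < C" by simp
    \<comment> \<open>The polynomial takes its minimum at \<open>t = - B / C\<close>.\<close>
    have "A + 2 * (- B / C) * B + (- B / C)\<^sup>2 * C = A - B\<^sup>2 / C"
      using False by (simp add: field_simps power2_eq_square)
    with quad[of "- B / C"] have "B\<^sup>2 / C \<le> A" by simp
    with \<open>0 < C\<close> have "B\<^sup>2 \<le> A * C" by (simp add: field_simps)
    thus ?thesis by (simp add: A_B_C_def)
  qed
qed

text \<open>Square integrability belongs to the notion because the integral of a non-integrable
  function is 0 by default, so the limit alone could hold vacuously.\<close>

definition L2_tendsto :: "'a measure \<Rightarrow> (nat \<Rightarrow> 'a \<Rightarrow> real) \<Rightarrow> ('a \<Rightarrow> real) \<Rightarrow> bool" where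
  "L2_tendsto M F f \<longleftrightarrow> (\<forall>j. sq_integrable M (F j)) \<and> sq_integrable M f \<and>
     (\<lambda>j. LINT x|M. (F j x - f x)\<^sup>2) \<longlonglongrightarrow> 0"

lemma L2_tendstoD:
  assumes "L2_tendsto M F f"
  shows "sq_integrable M (F j)" "sq_integrable M f"
    "(\<lambda>j. LINT x|M. (F j x - f x)\<^sup>2) \<longlonglongrightarrow> 0"
  using assms by (auto simp: L2_tendsto_def)

lemma L2_tendsto_zero: "L2_tendsto M (\<lambda>j x. 0) (\<lambda>x. 0)"
  by (simp add: L2_tendsto_def sq_integrable_zero)

lemma L2_tendsto_cmult:
  assumes "L2_tendsto M F f"
  shows "L2_tendsto M (\<lambda>j x. a * F j x) (\<lambda>x. a * f x)"
proof -
  have "(\<lambda>j. a\<^sup>2 * (LINT x|M. (F j x - f x)\<^sup>2)) \<longlonglongrightarrow> a\<^sup>2 * 0"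
    by (intro tendsto_intros L2_tendstoD[OF assms])
  moreover have "(a * F j x - a * f x)\<^sup>2 = a\<^sup>2 * (F j x - f x)\<^sup>2" for j x
    by (simp add: power_mult_distrib flip: right_diff_distrib)
  ultimately show ?thesis
    using assms by (auto simp: L2_tendsto_def intro: sq_integrable_cmult)
qed

lemma L2_tendsto_add:
  assumes "L2_tendsto M F f" "L2_tendsto M G g"
  shows "L2_tendsto M (\<lambda>j x. F j x + G j x) (\<lambda>x. f x + g x)"
proof -
  note sq = L2_tendstoD(1,2)[OF assms(1)] L2_tendstoD(1,2)[OF assms(2)]
  have "(\<lambda>j. LINT x|M. (F j x + G j x - (f x + g x))\<^sup>2) \<longlonglongrightarrow> 0"
  proof (rule tendsto_sandwich[where f = "\<lambda>_. 0"])
    show "(\<lambda>j. 2 * (LINT x|M. (F j x - f x)\<^sup>2) + 2 * (LINT x|M. (G j x - g x)\<^sup>2)) \<longlonglongrightarrow> 0"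
      by (auto intro!: tendsto_eq_intros L2_tendstoD assms)
    show "\<forall>\<^sub>F j in sequentially. (LINT x|M. (F j x + G j x - (f x + g x))\<^sup>2)
        \<le> 2 * (LINT x|M. (F j x - f x)\<^sup>2) + 2 * (LINT x|M. (G j x - g x)\<^sup>2)"
    proof (rule always_eventually, rule allI)
      fix j
      have eq: "F j x + G j x - (f x + g x) = (F j x - f x) + (G j x - g x)" for x by simp
      show "(LINT x|M. (F j x + G j x - (f x + g x))\<^sup>2)
        \<le> 2 * (LINT x|M. (F j x - f x)\<^sup>2) + 2 * (LINT x|M. (G j x - g x)\<^sup>2)"
        unfolding eq by (intro integral_square_add_le sq_integrable_diff sq)
    qed
  qed auto
  then show ?thesis using sq by (auto simp: L2_tendsto_def intro: sq_integrable_add)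
qed

lemma L2_tendsto_sum:
  "(\<And>k. k \<in> K \<Longrightarrow> L2_tendsto M (F k) (f k)) \<Longrightarrow>
    L2_tendsto M (\<lambda>j x. \<Sum>k\<in>K. F k j x) (\<lambda>x. \<Sum>k\<in>K. f k x)"
  by (induction K rule: infinite_finite_induct) (auto intro: L2_tendsto_add L2_tendsto_zero)

text \<open>Strong convergence implies weak convergence: by Cauchy-Schwarz the squared difference of
  the integrals is at most the squared distance times the squared norm of \<open>g\<close>.\<close>

lemma L2_tendsto_integral_mult:
  assumes "L2_tendsto M F f" "sq_integrable M g"
  shows "(\<lambda>j. LINT x|M. F j x * g x) \<longlonglongrightarrow> (LINT x|M. f x * g x)"
proof -
  note sq = L2_tendstoD(1,2)[OF assms(1)]
  have eq: "(LINT x|M. F j x * g x) - (LINT x|M. f x * g x) = (LINT x|M. (F j x - f x) * g x)" for j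
    using sq_integrable_mult[OF sq(1) assms(2), of j] sq_integrable_mult[OF sq(2) assms(2)]
    by (simp add: left_diff_distrib)
  have "(\<lambda>j. (LINT x|M. (F j x - f x) * g x)\<^sup>2) \<longlonglongrightarrow> 0"
  proof (rule tendsto_sandwich[where f = "\<lambda>_. 0"])
    show "\<forall>\<^sub>F j in sequentially. (LINT x|M. (F j x - f x) * g x)\<^sup>2
        \<le> (LINT x|M. (F j x - f x)\<^sup>2) * (LINT x|M. (g x)\<^sup>2)"
      by (intro always_eventually allI integral_mult_square_le sq_integrable_diff sq assms)
    show "(\<lambda>j. (LINT x|M. (F j x - f x)\<^sup>2) * (LINT x|M. (g x)\<^sup>2)) \<longlonglongrightarrow> 0"
      by (auto intro!: tendsto_eq_intros L2_tendstoD assms)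
  qed auto
  then have "(\<lambda>j. (LINT x|M. F j x * g x) - (LINT x|M. f x * g x)) \<longlonglongrightarrow> 0"
    by (simp add: eq)
  then show ?thesis by (rule LIM_zero_cancel)
qed

text \<open>Expanding the square of \<open>F j - f\<close> expresses the norm of \<open>F j\<close>
  through the distance to \<open>f\<close> and the pairing with \<open>f\<close>, whose limits are
  known.\<close>

lemma L2_tendsto_integral_square:
  assumes "L2_tendsto M F f"
  shows "(\<lambda>j. LINT x|M. (F j x)\<^sup>2) \<longlonglongrightarrow> (LINT x|M. (f x)\<^sup>2)"
proof -
  note sq = L2_tendstoD(1,2)[OF assms]
  have "(LINT x|M. (F j x)\<^sup>2) = (LINT x|M. (F j x - f x)\<^sup>2) + 2 * (LINT x|M. F j x * f x) - (LINT x|M. (f x)\<^sup>2)" for j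
  proof -
    have "(LINT x|M. (F j x - f x)\<^sup>2) =
       (LINT x|M. (F j x)\<^sup>2) - 2 * (LINT x|M. F j x * f x) + (LINT x|M. (f x)\<^sup>2)"
      using integral_square_add[OF sq(1) sq_integrable_cmult[OF sq(2), of "-1"], of j] by simp
    then show ?thesis by simp
  qed
  moreover have "(\<lambda>j. (LINT x|M. (F j x - f x)\<^sup>2) + 2 * (LINT x|M. F j x * f x) - (LINT x|M. (f x)\<^sup>2))
      \<longlonglongrightarrow> 0 + 2 * (LINT x|M. f x * f x) - (LINT x|M. (f x)\<^sup>2)"
    by (intro tendsto_intros L2_tendstoD L2_tendsto_integral_mult assms sq)
  ultimately show ?thesis by (simp add: power2_eq_square)
qed

text \<open>The Riesz-Fischer argument. Along a subsequence with squared distances below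
  \<open>(1/4)^k\<close> the differences have summable L1 norms, since the measure is finite. Their
  telescoping series therefore converges almost everywhere, and Fatou's lemma shows that the whole
  sequence tends to its sum in mean square.\<close>

lemma (in finite_measure) L2_complete:
  assumes F: "\<And>j. sq_integrable M (F j)"
    and Cauchy: "\<And>e. 0 < e \<Longrightarrow> \<exists>N. \<forall>i\<ge>N. \<forall>j\<ge>N. (LINT x|M. (F i x - F j x)\<^sup>2) < e"
  shows "\<exists>f. L2_tendsto M F f"
proof -
  have Fm [measurable]: "F j \<in> borel_measurable M" for j
    by (rule sq_integrable_measurable[OF F])
  have "\<exists>N. \<forall>k. \<forall>i\<ge>N k. \<forall>j\<ge>N k. (LINT x|M. (F i x - F j x)\<^sup>2) < (1/4)^k"
    by (intro choice allI Cauchy) simp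
  then obtain N where N: "\<And>k i j. i \<ge> N k \<Longrightarrow> j \<ge> N k \<Longrightarrow> (LINT x|M. (F i x - F j x)\<^sup>2) < (1/4)^k"
    by blast
  \<comment> \<open>The maximum makes \<open>r\<close> strictly increasing and keeps
    \<open>r k\<close> at or beyond the threshold \<open>N k\<close>.\<close>
  define r where "r = rec_nat (N 0) (\<lambda>k a. max (N (Suc k)) (Suc a))"
  have r_Suc: "r (Suc k) = max (N (Suc k)) (Suc (r k))" for k by (simp add: r_def)
  have rN: "N k \<le> r k" for k by (cases k) (auto simp: r_Suc, simp add: r_def)
  have r_mono: "strict_mono r" by (simp add: strict_mono_Suc_iff r_Suc less_max_iff_disj)
  define g where "g k x = F (r (Suc k)) x - F (r k) x" for k x
  have gm [measurable]: "g k \<in> borel_measurable M" for k unfolding g_def by measurable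
  have g_sq: "sq_integrable M (g k)" for k unfolding g_def by (intro sq_integrable_diff F)
  have g_le: "(LINT x|M. (g k x)\<^sup>2) \<le> (1/4)^k" for k
  proof -
    have "N k \<le> r (Suc k)" using rN[of k] by (simp add: r_Suc)
    then show ?thesis using N[OF _ rN, of k "r (Suc k)"] by (simp add: g_def less_imp_le)
  qed
  define K where "K = 1 + measure M (space M)"
  have g_L1: "(\<integral>\<^sup>+x. ennreal \<bar>g k x\<bar> \<partial>M) \<le> ennreal (K * (1/2)^k)" for k
  proof -
    have i: "integrable M (\<lambda>x. 2^k * (g k x)\<^sup>2 + (1/2)^k)"
      using sq_integrable_square[OF g_sq] by simp
    \<comment> \<open>AM-GM, weighted so that both terms have integral of order \<open>2\<^sup>-\<^sup>k\<close>\<close>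
    have pw: "\<bar>g k x\<bar> \<le> 2^k * (g k x)\<^sup>2 + (1/2)^k" for x
    proof -
      define t where "t = (2::real)^k"
      have t: "0 < t" by (simp add: t_def)
      have "t * \<bar>g k x\<bar> \<le> t\<^sup>2 * (g k x)\<^sup>2 + 1"
      proof -
        have "0 \<le> (t * \<bar>g k x\<bar> - 1)\<^sup>2" by simp
        hence "2 * (t * \<bar>g k x\<bar>) \<le> t\<^sup>2 * (g k x)\<^sup>2 + 1"
          by (simp add: power2_diff power_mult_distrib)
        moreover have "0 \<le> t * \<bar>g k x\<bar>" using t by simp
        ultimately show ?thesis by linarith
      qed
      hence "\<bar>g k x\<bar> \<le> t * (g k x)\<^sup>2 + 1 / t"
        using t by (simp add: field_simps power2_eq_square)
      then show ?thesis by (simp add: t_def power_one_over)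
    qed
    have "(\<integral>\<^sup>+x. ennreal \<bar>g k x\<bar> \<partial>M) \<le> (\<integral>\<^sup>+x. ennreal (2^k * (g k x)\<^sup>2 + (1/2)^k) \<partial>M)"
      by (intro nn_integral_mono ennreal_leI pw)
    also have "\<dots> = ennreal (LINT x|M. 2^k * (g k x)\<^sup>2 + (1/2)^k)"
      by (intro nn_integral_eq_integral i AE_I2) simp
    also have "(LINT x|M. 2^k * (g k x)\<^sup>2 + (1/2)^k) = 2^k * (LINT x|M. (g k x)\<^sup>2) + (1/2)^k * measure M (space M)"
      using sq_integrable_square[OF g_sq] by simp
    also have "\<dots> \<le> 2^k * (1/4)^k + (1/2)^k * measure M (space M)"
      using g_le[of k] by simp
    also have "2^k * (1/4)^k = ((1/2)^k :: real)"
      by (simp flip: power_mult_distrib)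
    finally show ?thesis by (simp add: K_def algebra_simps ennreal_leI)
  qed
  have "(\<integral>\<^sup>+x. (\<Sum>k. ennreal \<bar>g k x\<bar>) \<partial>M) = (\<Sum>k. \<integral>\<^sup>+x. ennreal \<bar>g k x\<bar> \<partial>M)"
    by (rule nn_integral_suminf) measurable
  also have "\<dots> \<le> (\<Sum>k. ennreal (K * (1/2)^k))"
    by (intro suminf_le g_L1) auto
  also have "\<dots> = ennreal (\<Sum>k. K * (1/2)^k)"
    by (intro suminf_ennreal2) (auto simp: K_def intro!: mult_nonneg_nonneg summable_mult summable_geometric)
  finally have "(\<integral>\<^sup>+x. (\<Sum>k. ennreal \<bar>g k x\<bar>) \<partial>M) \<noteq> \<infinity>"
    by (auto simp: top_unique)
  then have "AE x in M. (\<Sum>k. ennreal \<bar>g k x\<bar>) \<noteq> \<infinity>"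
    by (intro nn_integral_PInf_AE) measurable
  then have AE_summable: "AE x in M. summable (\<lambda>k. g k x)"
  proof eventually_elim
    case (elim x)
    have "summable (\<lambda>k. \<bar>g k x\<bar>)"
      using elim by (intro summable_suminf_not_top) auto
    then show ?case by (rule summable_rabs_cancel)
  qed
  \<comment> \<open>The partial sums telescope to \<open>F (r n) x\<close>; the value of
    \<open>f\<close> on the null set where the series diverges is immaterial.\<close>
  define f where "f x = F (r 0) x + (\<Sum>k. g k x)" for x
  have fm [measurable]: "f \<in> borel_measurable M" unfolding f_def by measurable
  have partial: "F (r 0) x + (\<Sum>k<n. g k x) = F (r n) x" for n x
    by (induction n) (auto simp: g_def)
  have AE_lim: "AE x in M. (\<lambda>n. F (r n) x) \<longlonglongrightarrow> f x"
    using AE_summable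
  proof eventually_elim
    case (elim x)
    then have "(\<lambda>n. F (r 0) x + (\<Sum>k<n. g k x)) \<longlonglongrightarrow> f x"
      unfolding f_def by (intro tendsto_intros summable_LIMSEQ)
    then show ?case by (simp add: partial)
  qed
  \<comment> \<open>Fatou's lemma along \<open>r\<close>: with m fixed, a bound on the distances
    from \<open>F m\<close> to all later terms passes to the limit \<open>f\<close>.\<close>
  have nn_le: "(\<integral>\<^sup>+x. ennreal ((F m x - f x)\<^sup>2) \<partial>M) \<le> ennreal e"
    if m: "\<And>j. j \<ge> m \<Longrightarrow> (LINT x|M. (F m x - F j x)\<^sup>2) \<le> e" for m e
  proof -
    have "(\<integral>\<^sup>+x. ennreal ((F m x - f x)\<^sup>2) \<partial>M)
        = (\<integral>\<^sup>+x. liminf (\<lambda>n. ennreal ((F m x - F (r n) x)\<^sup>2)) \<partial>M)"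
    proof (rule nn_integral_cong_AE)
      show "AE x in M. ennreal ((F m x - f x)\<^sup>2) = liminf (\<lambda>n. ennreal ((F m x - F (r n) x)\<^sup>2))"
        using AE_lim
      proof eventually_elim
        case (elim x)
        then have "(\<lambda>n. ennreal ((F m x - F (r n) x)\<^sup>2)) \<longlonglongrightarrow> ennreal ((F m x - f x)\<^sup>2)"
          by (intro tendsto_intros)
        then show ?case by (rule lim_imp_Liminf[OF sequentially_bot, symmetric])
      qed
    qed
    also have "\<dots> \<le> liminf (\<lambda>n. \<integral>\<^sup>+x. ennreal ((F m x - F (r n) x)\<^sup>2) \<partial>M)"
      by (rule nn_integral_liminf) measurable
    also have "\<dots> \<le> limsup (\<lambda>n. \<integral>\<^sup>+x. ennreal ((F m x - F (r n) x)\<^sup>2) \<partial>M)"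
      by (intro Liminf_le_Limsup) simp
    also have "\<dots> \<le> ennreal e"
    proof (rule Limsup_bounded)
      show "\<forall>\<^sub>F n in sequentially. (\<integral>\<^sup>+x. ennreal ((F m x - F (r n) x)\<^sup>2) \<partial>M) \<le> ennreal e"
        using eventually_ge_at_top[of m]
      proof eventually_elim
        case (elim n)
        then have "m \<le> r n" using seq_suble[OF r_mono, of n] by simp
        then show ?case
          by (subst nn_integral_eq_integral)
            (auto intro!: ennreal_leI m sq_integrable_square[OF sq_integrable_diff] F)
      qed
    qed
    finally show ?thesis .
  qed
  have int: "sq_integrable M (\<lambda>x. F m x - f x)" "(LINT x|M. (F m x - f x)\<^sup>2) \<le> e"
    if m: "\<And>j. j \<ge> m \<Longrightarrow> (LINT x|M. (F m x - F j x)\<^sup>2) \<le> e" and "0 \<le> e" for m e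
  proof -
    have le: "(\<integral>\<^sup>+x. ennreal ((F m x - f x)\<^sup>2) \<partial>M) \<le> ennreal e"
      using m by (rule nn_le)
    then have i: "integrable M (\<lambda>x. (F m x - f x)\<^sup>2)"
      by (intro integrableI_nonneg) (auto simp: less_top[symmetric] top_unique neq_top_trans)
    then show "sq_integrable M (\<lambda>x. F m x - f x)" by (simp add: sq_integrable_def)
    show "(LINT x|M. (F m x - f x)\<^sup>2) \<le> e"
      using le \<open>0 \<le> e\<close> by (subst (asm) nn_integral_eq_integral[OF i]) auto
  qed
  have f_sq: "sq_integrable M f"
  proof -
    obtain N where "\<forall>i\<ge>N. \<forall>j\<ge>N. (LINT x|M. (F i x - F j x)\<^sup>2) < 1" using Cauchy[of 1] by auto
    then have "sq_integrable M (\<lambda>x. F N x - f x)" by (intro int(1)[of N 1]) (auto intro: less_imp_le)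
    from sq_integrable_diff[OF F[of N] this] show ?thesis by simp
  qed
  have "(\<lambda>j. LINT x|M. (F j x - f x)\<^sup>2) \<longlonglongrightarrow> 0"
  proof (rule LIMSEQ_I)
    fix e :: real assume "0 < e"
    then obtain N where N: "\<forall>i\<ge>N. \<forall>j\<ge>N. (LINT x|M. (F i x - F j x)\<^sup>2) < e / 2"
      using Cauchy[of "e / 2"] by auto
    have "norm ((LINT x|M. (F m x - f x)\<^sup>2) - 0) < e" if "m \<ge> N" for m
    proof -
      have "(LINT x|M. (F m x - f x)\<^sup>2) \<le> e / 2"
        using that N \<open>0 < e\<close> by (intro int(2)) (auto intro: less_imp_le)
      then show ?thesis using \<open>0 < e\<close> by simp
    qed
    then show "\<exists>N. \<forall>m\<ge>N. norm ((LINT x|M. (F m x - f x)\<^sup>2) - 0) < e" by blast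
  qed
  then show ?thesis using F f_sq by (auto simp: L2_tendsto_def)
qed

subsection \<open>Gradients and translations\<close>

text \<open>Holds of test functions and passes to finite linear combinations with only first
  derivatives to check. Vanishing off \<Omega> lets the gradient be integrated over the whole space,
  where translations act.\<close>

definition C1_supported_in :: "(real^'n::finite) set \<Rightarrow> (real^'n \<Rightarrow> real) \<Rightarrow> bool" where
  "C1_supported_in \<Omega> f \<longleftrightarrow> (\<forall>x. f differentiable at x) \<and> continuous_on UNIV (grad f) \<and>
     (\<forall>x. x \<notin> \<Omega> \<longrightarrow> f x = 0 \<and> grad f x = 0)"

lemma has_derivative_grad:
  fixes f :: "real^'n::finite \<Rightarrow> real"
  assumes "f differentiable at x"
  shows "(f has_derivative (\<lambda>h. grad f x \<bullet> h)) (at x)"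
proof -
  let ?D = "frechet_derivative f (at x)"
  have D: "(f has_derivative ?D) (at x)"
    using assms by (simp add: frechet_derivative_works)
  have "?D h = grad f x \<bullet> h" for h
  proof -
    interpret linear ?D using D by (rule has_derivative_linear)
    have "?D h = ?D (\<Sum>i\<in>UNIV. h $ i *\<^sub>R axis i 1)"
      by (simp add: basis_expansion flip: scalar_mult_eq_scaleR)
    also have "\<dots> = (\<Sum>i\<in>UNIV. h $ i * ?D (axis i 1))"
      by (simp add: sum scale)
    finally show ?thesis by (simp add: inner_vec_def grad_def partial_deriv_def mult.commute)
  qed
  then have "?D = (\<lambda>h. grad f x \<bullet> h)" by blast
  with D show ?thesis by metis
qed

lemma grad_eqI:
  fixes f :: "real^'n::finite \<Rightarrow> real"
  assumes "(f has_derivative (\<lambda>h. v \<bullet> h)) (at x)"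
  shows "grad f x = v"
proof -
  have "frechet_derivative f (at x) = (\<lambda>h. v \<bullet> h)"
    using assms frechet_derivative_at by metis
  then show ?thesis by (simp add: grad_def partial_deriv_def vec_eq_iff inner_axis)
qed

lemma test_function_C1:
  fixes \<psi> :: "real^'n::finite \<Rightarrow> real"
  assumes "test_function \<Omega> \<psi>"
  shows "C1_supported_in \<Omega> \<psi>"
proof -
  have "Ck_on (Suc 0) UNIV \<psi>"
    using assms by (auto simp: test_function_def smooth_on_def simp del: Ck_on.simps)
  then have diff: "\<psi> differentiable at x" and pd: "continuous_on UNIV (partial_deriv i \<psi>)" for x i
    by auto
  have "continuous_on UNIV (grad \<psi>)"
    unfolding grad_def using pd by (intro continuous_intros)
  moreover have "\<psi> x = 0 \<and> grad \<psi> x = 0" if "x \<notin> \<Omega>" for x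
  proof -
    \<comment> \<open>The complement of the support is an open neighbourhood of x on which
      \<open>\<psi>\<close> is zero, so the gradient at x is zero as well.\<close>
    define U where "U = - closure {x. \<psi> x \<noteq> 0}"
    have x: "x \<in> U" "open U"
      using assms that by (auto simp: test_function_def U_def)
    have z: "\<psi> y = 0" if "y \<in> U" for y
      using that closure_subset[of "{x. \<psi> x \<noteq> 0}"] by (auto simp: U_def)
    have "((\<lambda>_. 0) has_derivative (\<lambda>h. 0 \<bullet> h)) (at x)" by simp
    then have "(\<psi> has_derivative (\<lambda>h. 0 \<bullet> h)) (at x)"
      by (rule has_derivative_transform_within_open[OF _ x(2,1)]) (simp add: z)
    then show ?thesis using z[OF x(1)] grad_eqI by blast
  qed
  ultimately show ?thesis using diff by (auto simp: C1_supported_in_def)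
qed

lemma C1_supported_linear_combination:
  fixes \<psi> :: "'k \<Rightarrow> real^'n::finite \<Rightarrow> real"
  assumes "finite K" "\<And>k. k \<in> K \<Longrightarrow> C1_supported_in \<Omega> (\<psi> k)"
  shows "C1_supported_in \<Omega> (\<lambda>x. \<Sum>k\<in>K. a k * \<psi> k x)"
    and "grad (\<lambda>x. \<Sum>k\<in>K. a k * \<psi> k x) = (\<lambda>x. \<Sum>k\<in>K. a k *\<^sub>R grad (\<psi> k) x)"
proof -
  have D: "((\<lambda>x. \<Sum>k\<in>K. a k * \<psi> k x) has_derivative
      (\<lambda>h. (\<Sum>k\<in>K. a k *\<^sub>R grad (\<psi> k) x) \<bullet> h)) (at x)" for x
  proof -
    have "((\<lambda>x. \<Sum>k\<in>K. a k * \<psi> k x) has_derivative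
      (\<lambda>h. \<Sum>k\<in>K. a k * (grad (\<psi> k) x \<bullet> h))) (at x)"
      using assms(2) by (intro has_derivative_sum has_derivative_mult_right has_derivative_grad)
        (auto simp: C1_supported_in_def)
    then show ?thesis by (simp add: inner_sum_left)
  qed
  show g: "grad (\<lambda>x. \<Sum>k\<in>K. a k * \<psi> k x) = (\<lambda>x. \<Sum>k\<in>K. a k *\<^sub>R grad (\<psi> k) x)"
    using grad_eqI[OF D] by auto
  have "continuous_on UNIV (\<lambda>x. \<Sum>k\<in>K. a k *\<^sub>R grad (\<psi> k) x)"
    using assms(2) by (intro continuous_intros) (auto simp: C1_supported_in_def)
  then show "C1_supported_in \<Omega> (\<lambda>x. \<Sum>k\<in>K. a k * \<psi> k x)"
    using D assms(2) unfolding C1_supported_in_def g by (auto simp: differentiable_def)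
qed

lemma C1_supported_continuous:
  "C1_supported_in \<Omega> f \<Longrightarrow> continuous_on UNIV f"
  by (auto simp: C1_supported_in_def intro!: differentiable_imp_continuous_on
        simp: differentiable_on_def intro: differentiable_at_withinI)

text \<open>The integral of the square of \<open>g - d\<close> over the unit interval is
  nonnegative, where \<open>d = F 1 - F 0\<close> is the mean of \<open>g\<close>. The bound is
  written as a nonnegative Lebesgue integral so that Tonelli's theorem applies to it later.\<close>

lemma unit_interval_Jensen:
  fixes g :: "real \<Rightarrow> real"
  assumes g: "continuous_on UNIV g" and F: "\<And>t. (F has_real_derivative g t) (at t)"
  shows "ennreal ((F 1 - F 0)\<^sup>2) \<le> (\<integral>\<^sup>+t. ennreal ((g t)\<^sup>2) * indicator {0..1} t \<partial>lborel)"
proof -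
  define d where "d = F 1 - F 0"
  have gi: "(g has_integral d) {0..1}"
    unfolding d_def using F
    by (intro fundamental_theorem_of_calculus)
      (auto simp flip: has_real_derivative_iff_has_vector_derivative intro: DERIV_subset)
  have g2: "(\<lambda>t. (g t)\<^sup>2) integrable_on {0..1}"
    by (intro integrable_continuous_real continuous_intros continuous_on_subset[OF g]) auto
  have "((\<lambda>t. (g t)\<^sup>2 - 2 * d * g t + d\<^sup>2) has_integral
      (integral {0..1} (\<lambda>t. (g t)\<^sup>2) - 2 * d * d + d\<^sup>2)) {0..1}"
    using integrable_integral[OF g2] gi has_integral_const_real[of "d\<^sup>2" 0 1]
    by (intro has_integral_add has_integral_diff has_integral_mult_right) auto
  then have "0 \<le> integral {0..1} (\<lambda>t. (g t)\<^sup>2) - 2 * d * d + d\<^sup>2"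
    by (rule has_integral_nonneg) (use zero_le_power2[of "g _ - d"] in \<open>simp add: power2_diff algebra_simps\<close>)
  then have le: "d\<^sup>2 \<le> integral {0..1} (\<lambda>t. (g t)\<^sup>2)"
    by (simp add: power2_eq_square)
  have "((\<lambda>t. if t \<in> {0..1} then (g t)\<^sup>2 else 0) has_integral integral {0..1} (\<lambda>t. (g t)\<^sup>2)) UNIV"
    using integrable_integral[OF g2] by (subst has_integral_restrict_UNIV)
  then have "((\<lambda>t. (g t)\<^sup>2 * indicator {0..1} t) has_integral integral {0..1} (\<lambda>t. (g t)\<^sup>2)) UNIV"
    by (rule has_integral_eq[rotated]) auto
  moreover have "g \<in> borel_measurable borel"
    using g by (rule borel_measurable_continuous_onI)
  ultimately have "(\<integral>\<^sup>+t. ennreal ((g t)\<^sup>2 * indicator {0..1} t) \<partial>lborel) =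
      ennreal (integral {0..1} (\<lambda>t. (g t)\<^sup>2))"
    by (intro nn_integral_has_integral_lborel) auto
  then show ?thesis
    using le by (simp add: d_def ennreal_mult ennreal_indicator ennreal_leI)
qed

text \<open>On the segment from x to \<open>x + h\<close> the squared increment is at most the mean
  of the squared directional derivative, hence of \<open>(norm h)^2\<close> times the squared
  gradient. Integrating over x and exchanging the integrals leaves translates of the gradient, whose
  integrals do not depend on t.\<close>

lemma translation_estimate:
  fixes \<psi> :: "real^'n::finite \<Rightarrow> real"
  assumes "C1_supported_in \<Omega> \<psi>"
  shows "(\<integral>\<^sup>+x. ennreal ((\<psi> (x + h) - \<psi> x)\<^sup>2) \<partial>lborel)
    \<le> ennreal ((norm h)\<^sup>2) * (\<integral>\<^sup>+x. ennreal ((norm (grad \<psi> x))\<^sup>2) \<partial>lborel)"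
proof -
  have c: "continuous_on UNIV (grad \<psi>)" and D: "\<And>x. \<psi> differentiable at x"
    using assms by (auto simp: C1_supported_in_def)
  have gm [measurable]: "grad \<psi> \<in> borel_measurable borel"
    using c by (rule borel_measurable_continuous_onI)
  define G where "G x = (norm (grad \<psi> x))\<^sup>2" for x
  have Gm [measurable]: "G \<in> borel_measurable borel" unfolding G_def by measurable
  have "ennreal ((\<psi> (x + h) - \<psi> x)\<^sup>2) \<le>
      (\<integral>\<^sup>+t. ennreal ((norm h)\<^sup>2) * (ennreal (G (x + t *\<^sub>R h)) * indicator {0..1} t) \<partial>lborel)" for x
  proof -
    have "((\<lambda>t. \<psi> (x + t *\<^sub>R h)) has_real_derivative (grad \<psi> (x + t *\<^sub>R h) \<bullet> h)) (at t)" for t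
    proof -
      have "((\<lambda>t. \<psi> (x + t *\<^sub>R h)) has_derivative (\<lambda>s. grad \<psi> (x + t *\<^sub>R h) \<bullet> (s *\<^sub>R h))) (at t)"
        by (rule has_derivative_compose[OF _ has_derivative_grad[OF D]]) (auto intro!: derivative_eq_intros)
      then show ?thesis
        by (simp add: has_field_derivative_def mult_commute_abs)
    qed
    moreover have "continuous_on UNIV (\<lambda>t. grad \<psi> (x + t *\<^sub>R h) \<bullet> h)"
      by (intro continuous_intros continuous_on_compose2[OF c]) auto
    ultimately have "ennreal ((\<psi> (x + 1 *\<^sub>R h) - \<psi> (x + 0 *\<^sub>R h))\<^sup>2)
        \<le> (\<integral>\<^sup>+t. ennreal ((grad \<psi> (x + t *\<^sub>R h) \<bullet> h)\<^sup>2) * indicator {0..1} t \<partial>lborel)"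
      by (intro unit_interval_Jensen)
    also have "\<dots> \<le> (\<integral>\<^sup>+t. ennreal ((norm h)\<^sup>2) * (ennreal (G (x + t *\<^sub>R h)) * indicator {0..1} t) \<partial>lborel)"
    proof (intro nn_integral_mono)
      fix t :: real
      have "(grad \<psi> (x + t *\<^sub>R h) \<bullet> h)\<^sup>2 \<le> (norm h)\<^sup>2 * G (x + t *\<^sub>R h)"
        using Cauchy_Schwarz_ineq[of "grad \<psi> (x + t *\<^sub>R h)" h]
        by (simp add: G_def power2_norm_eq_inner mult.commute)
      then show "ennreal ((grad \<psi> (x + t *\<^sub>R h) \<bullet> h)\<^sup>2) * indicator {0..1} t
          \<le> ennreal ((norm h)\<^sup>2) * (ennreal (G (x + t *\<^sub>R h)) * indicator {0..1} t)"
        by (auto split: split_indicator simp: ennreal_leI G_def simp flip: ennreal_mult)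
    qed
    finally show ?thesis by simp
  qed
  then have "(\<integral>\<^sup>+x. ennreal ((\<psi> (x + h) - \<psi> x)\<^sup>2) \<partial>lborel) \<le>
      (\<integral>\<^sup>+x. \<integral>\<^sup>+t. ennreal ((norm h)\<^sup>2) * (ennreal (G (x + t *\<^sub>R h)) * indicator {0..1} t) \<partial>lborel \<partial>lborel)"
    by (intro nn_integral_mono)
  also have "\<dots> = (\<integral>\<^sup>+t. \<integral>\<^sup>+x. ennreal ((norm h)\<^sup>2) * (ennreal (G (x + t *\<^sub>R h)) * indicator {0..1} (t::real)) \<partial>lborel \<partial>lborel)"
    by (rule lborel_pair.Fubini') measurable
  also have "\<dots> = (\<integral>\<^sup>+t. ennreal ((norm h)\<^sup>2) * (\<integral>\<^sup>+x. ennreal (G x) \<partial>lborel) * indicator {0..1} (t::real) \<partial>lborel)"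
  proof (rule nn_integral_cong)
    fix t :: real
    have "(\<integral>\<^sup>+x. ennreal (G x) \<partial>lborel) = (\<integral>\<^sup>+x. ennreal (G x) \<partial>distr lborel borel ((+) (t *\<^sub>R h)))"
      by (simp add: lborel_distr_plus)
    also have "\<dots> = (\<integral>\<^sup>+x. ennreal (G (x + t *\<^sub>R h)) \<partial>lborel)"
      by (subst nn_integral_distr) (auto simp: add.commute)
    finally show "(\<integral>\<^sup>+x. ennreal ((norm h)\<^sup>2) * (ennreal (G (x + t *\<^sub>R h)) * indicator {0..1} t) \<partial>lborel)
        = ennreal ((norm h)\<^sup>2) * (\<integral>\<^sup>+x. ennreal (G x) \<partial>lborel) * indicator {0..1} t"
      by (simp add: nn_integral_cmult nn_integral_multc mult.assoc)
  qed
  also have "\<dots> = ennreal ((norm h)\<^sup>2) * (\<integral>\<^sup>+x. ennreal (G x) \<partial>lborel)"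
    by (simp add: nn_integral_cmult_indicator)
  finally show ?thesis by (simp add: G_def)
qed

subsection \<open>Growth of the Dirichlet eigenvalues\<close>

lemma L2_iff: "f \<in> L2 \<Omega> \<longleftrightarrow> sq_integrable (lebesgue_on \<Omega>) f"
  by (simp add: L2_def sq_integrable_def)

lemma integral_square_sum:
  assumes "\<And>k. k \<in> K \<Longrightarrow> sq_integrable M (f k)"
  shows "(LINT x|M. (\<Sum>k\<in>K. a k * f k x)\<^sup>2) = (\<Sum>k\<in>K. \<Sum>l\<in>K. a k * a l * (LINT x|M. f k x * f l x))"
proof -
  have i: "integrable M (\<lambda>x. f k x * f l x)" if "k \<in> K" "l \<in> K" for k l
    using assms that by (intro sq_integrable_mult) auto
  have "(LINT x|M. (\<Sum>k\<in>K. a k * f k x)\<^sup>2) = (LINT x|M. (\<Sum>k\<in>K. \<Sum>l\<in>K. a k * a l * (f k x * f l x)))"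
    by (simp add: power2_eq_square sum_product algebra_simps)
  also have "\<dots> = (\<Sum>k\<in>K. \<Sum>l\<in>K. (LINT x|M. a k * a l * (f k x * f l x)))"
  proof (subst Bochner_Integration.integral_sum)
    show "integrable M (\<lambda>x. \<Sum>l\<in>K. a k * a l * (f k x * f l x))" if "k \<in> K" for k
      using i that by (intro Bochner_Integration.integrable_sum Bochner_Integration.integrable_mult_right) auto
    show "(\<Sum>k\<in>K. LINT x|M. (\<Sum>l\<in>K. a k * a l * (f k x * f l x)))
        = (\<Sum>k\<in>K. \<Sum>l\<in>K. (LINT x|M. a k * a l * (f k x * f l x)))"
      using i by (intro sum.cong refl Bochner_Integration.integral_sum
          Bochner_Integration.integrable_mult_right) auto
  qed
  finally show ?thesis by simp
qed

lemma square_norm_vec: "(norm (v::real^'n::finite))\<^sup>2 = (\<Sum>i\<in>UNIV. (v $ i)\<^sup>2)"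
  unfolding power2_norm_eq_inner inner_vec_def by (simp add: power2_eq_square)

section \<open>Integration over a bounded open domain\<close>

context
  fixes \<Omega> :: "(real^'n::finite) set"
  assumes open_\<Omega>: "open \<Omega>" and bounded_\<Omega>: "bounded \<Omega>"
begin

lemma domain_lmeasurable: "\<Omega> \<in> lmeasurable"
  using open_\<Omega> bounded_\<Omega> by (simp add: lmeasurable_open)

lemma finite_measure_domain: "finite_measure (lebesgue_on \<Omega>)"
  by (rule finite_measure_lebesgue_on[OF domain_lmeasurable])

text \<open>Passes from the restricted complete measure to \<open>lborel\<close>, where translation
  invariance and Tonelli's theorem are used.\<close>

lemma nn_integral_domain:
  "(\<integral>\<^sup>+x. g x \<partial>lebesgue_on \<Omega>) = (\<integral>\<^sup>+x. g x * indicator \<Omega> x \<partial>lborel)"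
  using domain_lmeasurable by (simp add: nn_integral_restrict_space nn_integral_completion fmeasurableD)

lemma borel_measurable_domain:
  assumes "f \<in> borel_measurable borel"
  shows "f \<in> borel_measurable (lebesgue_on \<Omega>)"
  using assms by (intro measurable_restrict_space1 measurable_completion) simp

lemma sq_integrable_bounded:
  assumes "f \<in> borel_measurable borel" "\<And>x. x \<in> \<Omega> \<Longrightarrow> \<bar>f x\<bar> \<le> B"
  shows "sq_integrable (lebesgue_on \<Omega>) f"
proof -
  interpret finite_measure "lebesgue_on \<Omega>" by (rule finite_measure_domain)
  have [measurable]: "f \<in> borel_measurable (lebesgue_on \<Omega>)"
    by (rule borel_measurable_domain[OF assms(1)])
  have "integrable (lebesgue_on \<Omega>) (\<lambda>x. (f x)\<^sup>2)"
  proof (rule integrable_const_bound)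
    show "AE x in lebesgue_on \<Omega>. norm ((f x)\<^sup>2) \<le> B\<^sup>2"
    proof (rule AE_I2)
      fix x assume "x \<in> space (lebesgue_on \<Omega>)"
      then have "\<bar>f x\<bar> \<le> B" by (auto intro: assms(2))
      then show "norm ((f x)\<^sup>2) \<le> B\<^sup>2" using power_mono[of "\<bar>f x\<bar>" B 2] by simp
    qed
  qed measurable
  then show ?thesis by (simp add: sq_integrable_def)
qed

lemma sq_integrable_continuous:
  assumes "continuous_on UNIV f"
  shows "sq_integrable (lebesgue_on \<Omega>) f"
proof -
  have "compact (f ` closure \<Omega>)"
    using bounded_\<Omega> by (intro compact_continuous_image continuous_on_subset[OF assms]) auto
  then obtain B where "\<And>x. x \<in> closure \<Omega> \<Longrightarrow> norm (f x) \<le> B"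
    by (meson bounded_iff compact_imp_bounded imageI)
  then show ?thesis
    using closure_subset by (intro sq_integrable_bounded borel_measurable_continuous_onI assms) auto
qed

lemma sq_integrable_C1:
  assumes "C1_supported_in \<Omega> f"
  shows "sq_integrable (lebesgue_on \<Omega>) f" "sq_integrable (lebesgue_on \<Omega>) (\<lambda>x. grad f x $ i)"
  using assms
  by (auto intro!: sq_integrable_continuous C1_supported_continuous continuous_intros simp: C1_supported_in_def)

text \<open>Restates the convergence of the gradients component by component, so that the calculus
  of \<open>L2_tendsto\<close> for scalar functions applies.\<close>

lemma H10_approximation:
  assumes "H10_with_gradient \<Omega> f G"
  obtains \<psi> where "\<And>j. test_function \<Omega> (\<psi> j)" "L2_tendsto (lebesgue_on \<Omega>) \<psi> f"
    "\<And>i. L2_tendsto (lebesgue_on \<Omega>) (\<lambda>j x. grad (\<psi> j) x $ i) (\<lambda>x. G x $ i)"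
proof -
  let ?M = "lebesgue_on \<Omega>"
  from assms obtain \<psi> where \<psi>: "\<And>j. test_function \<Omega> (\<psi> j)"
    and f: "sq_integrable ?M f" and G: "\<And>i. sq_integrable ?M (\<lambda>x. G x $ i)"
    and lim: "(\<lambda>j. LINT x|?M. (\<psi> j x - f x)\<^sup>2) \<longlonglongrightarrow> 0"
      "(\<lambda>j. LINT x|?M. (norm (grad (\<psi> j) x - G x))\<^sup>2) \<longlonglongrightarrow> 0"
    by (auto simp: H10_with_gradient_def L2_iff)
  note C1 = test_function_C1[OF \<psi>]
  note sq = sq_integrable_C1[OF C1]
  have d: "sq_integrable ?M (\<lambda>x. grad (\<psi> j) x $ i - G x $ i)" for i j
    by (intro sq_integrable_diff sq G)
  have "(\<lambda>j. LINT x|?M. (grad (\<psi> j) x $ i - G x $ i)\<^sup>2) \<longlonglongrightarrow> 0" for i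
  proof (rule tendsto_sandwich[OF _ _ tendsto_const lim(2)])
    show "\<forall>\<^sub>F j in sequentially. (LINT x|?M. (grad (\<psi> j) x $ i - G x $ i)\<^sup>2)
        \<le> (LINT x|?M. (norm (grad (\<psi> j) x - G x))\<^sup>2)"
    proof (intro always_eventually allI integral_mono)
      fix j
      show "integrable ?M (\<lambda>x. (grad (\<psi> j) x $ i - G x $ i)\<^sup>2)" by (rule sq_integrable_square[OF d])
      show "integrable ?M (\<lambda>x. (norm (grad (\<psi> j) x - G x))\<^sup>2)"
        unfolding square_norm_vec vector_minus_component
        by (intro Bochner_Integration.integrable_sum sq_integrable_square[OF d])
      show "(grad (\<psi> j) x $ i - G x $ i)\<^sup>2 \<le> (norm (grad (\<psi> j) x - G x))\<^sup>2" for x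
        using component_le_norm_cart[of "grad (\<psi> j) x - G x" i]
        by (simp add: abs_le_square_iff[symmetric])
    qed
  qed auto
  then show thesis
    using \<psi> f G lim sq by (intro that) (auto simp: L2_tendsto_def)
qed

end

section \<open>Eigenfunction expansions and their approximation by C1 functions\<close>

locale eigensystem =
  fixes \<Omega> :: "(real^'n::finite) set" and ev :: "nat \<Rightarrow> real" and \<phi> :: "nat \<Rightarrow> real^'n \<Rightarrow> real"
  assumes domain: "smooth_bounded_domain \<Omega>"
    and system: "dirichlet_eigensystem \<Omega> ev \<phi>"
begin

abbreviation "M \<equiv> lebesgue_on \<Omega>"
abbreviation "fourier_coeff f k \<equiv> eigen_coeff \<Omega> \<phi> f k"

lemma open_domain: "open \<Omega>" and bounded_domain: "bounded \<Omega>" and nonempty_domain: "\<Omega> \<noteq> {}"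
  using domain by (auto simp: smooth_bounded_domain_def)

sublocale finite_measure M
  by (rule finite_measure_domain[OF open_domain bounded_domain])

lemma ev_mono: "incseq ev" and ev0_pos: "0 < ev 0"
  using system by (auto simp: dirichlet_eigensystem_def)

lemma ev_pos: "0 < ev k"
  using ev0_pos ev_mono by (meson incseqD le0 less_le_trans)

lemma orthonormal: "(LINT x|M. \<phi> j x * \<phi> k x) = (if j = k then 1 else 0)"
  using system by (auto simp: dirichlet_eigensystem_def L2_inner_def)

lemma eigenfunction_sq_integrable: "sq_integrable M (\<phi> k)"
  using system
  by (auto simp: dirichlet_eigensystem_def dirichlet_eigenfunction_def H10_with_gradient_def L2_iff)

lemma fourier_coeff_eq: "fourier_coeff f k = (LINT x|M. f x * \<phi> k x)"
  by (simp add: eigen_coeff_def L2_inner_def)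

lemma combination_sq_integrable: "sq_integrable M (\<lambda>x. \<Sum>k\<in>K. a k * \<phi> k x)"
  by (intro sq_integrable_sum sq_integrable_cmult eigenfunction_sq_integrable)

lemma expansion:
  assumes "sq_integrable M f"
  shows "L2_tendsto M (\<lambda>N x. \<Sum>k<N. fourier_coeff f k * \<phi> k x) f"
  using system assms
  by (auto simp: dirichlet_eigensystem_def L2_tendsto_def L2_iff power2_commute intro: combination_sq_integrable)

text \<open>By orthonormality the squared norm of a partial expansion is a partial sum of the
  series, and squared norms converge along the expansion.\<close>

lemma Parseval:
  assumes "sq_integrable M f"
  shows "(\<lambda>k. (fourier_coeff f k)\<^sup>2) sums (LINT x|M. (f x)\<^sup>2)"
proof -
  have "(LINT x|M. (\<Sum>k<N. fourier_coeff f k * \<phi> k x)\<^sup>2) = (\<Sum>k<N. (fourier_coeff f k)\<^sup>2)" for N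
    by (subst integral_square_sum)
      (auto simp: eigenfunction_sq_integrable orthonormal power2_eq_square if_distrib cong: if_cong)
  then show ?thesis
    using L2_tendsto_integral_square[OF expansion[OF assms]] by (simp add: sums_def)
qed

text \<open>The weak gradients of the eigenfunctions are orthogonal with squared norms
  \<open>ev k\<close>. Replacing each eigenfunction by test functions that approximate it together
  with its gradient yields the weighted sum of squares in the limit.\<close>

lemma combination_approximation:
  obtains \<psi> where "\<And>j. C1_supported_in \<Omega> (\<psi> j)"
    "L2_tendsto M \<psi> (\<lambda>x. \<Sum>k<N. a k * \<phi> k x)"
    "(\<lambda>j. LINT x|M. (norm (grad (\<psi> j) x))\<^sup>2) \<longlonglongrightarrow> (\<Sum>k<N. ev k * (a k)\<^sup>2)"
proof -
  have "\<exists>G. H10_with_gradient \<Omega> (\<phi> k) G \<and> (\<forall>\<psi>. test_function \<Omega> \<psi> \<longrightarrow>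
      (LINT x|M. G x \<bullet> grad \<psi> x) = ev k * L2_inner \<Omega> (\<phi> k) \<psi>)" for k
    using system by (auto simp: dirichlet_eigensystem_def dirichlet_eigenfunction_def)
  then obtain G where G: "\<And>k. H10_with_gradient \<Omega> (\<phi> k) (G k)"
    and weak: "\<And>k \<psi>. test_function \<Omega> \<psi> \<Longrightarrow>
      (LINT x|M. G k x \<bullet> grad \<psi> x) = ev k * L2_inner \<Omega> (\<phi> k) \<psi>"
    by metis
  have "\<exists>\<psi>. (\<forall>j. test_function \<Omega> (\<psi> j)) \<and> L2_tendsto M \<psi> (\<phi> k) \<and>
    (\<forall>i. L2_tendsto M (\<lambda>j x. grad (\<psi> j) x $ i) (\<lambda>x. G k x $ i))" for k
    using H10_approximation[OF open_domain bounded_domain G[of k]] by metis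
  then obtain \<Psi> where \<Psi>: "\<And>k j. test_function \<Omega> (\<Psi> k j)" "\<And>k. L2_tendsto M (\<Psi> k) (\<phi> k)"
    "\<And>k i. L2_tendsto M (\<lambda>j x. grad (\<Psi> k j) x $ i) (\<lambda>x. G k x $ i)"
    by metis
  note Gsq = L2_tendstoD(2)[OF \<Psi>(3)]
  note C1 = test_function_C1[OF \<Psi>(1)]
  note sqC1 = sq_integrable_C1[OF open_domain bounded_domain]
  \<comment> \<open>One sequence with two limits: convergence of the gradients of
    \<open>\<Psi> l j\<close> gives the left side, while the weak equation for
    \<open>\<phi> k\<close> tested with \<open>\<Psi> l j\<close>, and orthonormality, give the
    right side.\<close>
  have GG: "(\<Sum>i\<in>UNIV. LINT x|M. G k x $ i * G l x $ i) = (if k = l then ev k else 0)" for k l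
  proof (rule LIMSEQ_unique)
    have "(\<lambda>j. \<Sum>i\<in>UNIV. LINT x|M. grad (\<Psi> l j) x $ i * G k x $ i)
        \<longlonglongrightarrow> (\<Sum>i\<in>UNIV. LINT x|M. G l x $ i * G k x $ i)"
      by (intro tendsto_sum L2_tendsto_integral_mult \<Psi> Gsq)
    moreover have "(\<Sum>i\<in>UNIV. LINT x|M. grad (\<Psi> l j) x $ i * G k x $ i) = (LINT x|M. G k x \<bullet> grad (\<Psi> l j) x)" for j
      unfolding inner_vec_def
      by (subst Bochner_Integration.integral_sum)
        (auto simp: mult.commute intro!: sq_integrable_mult Gsq sqC1 C1)
    ultimately show "(\<lambda>j. LINT x|M. G k x \<bullet> grad (\<Psi> l j) x) \<longlonglongrightarrow> (\<Sum>i\<in>UNIV. LINT x|M. G k x $ i * G l x $ i)"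
      by (simp add: mult.commute)
    have "(\<lambda>j. ev k * (LINT x|M. \<Psi> l j x * \<phi> k x)) \<longlonglongrightarrow> ev k * (LINT x|M. \<phi> l x * \<phi> k x)"
      by (intro tendsto_intros L2_tendsto_integral_mult \<Psi> eigenfunction_sq_integrable)
    then show "(\<lambda>j. LINT x|M. G k x \<bullet> grad (\<Psi> l j) x) \<longlonglongrightarrow> (if k = l then ev k else 0)"
      by (simp add: weak[OF \<Psi>(1)] L2_inner_def mult.commute orthonormal eq_commute[of l k] if_distrib cong: if_cong)
  qed
  define \<psi> where "\<psi> j x = (\<Sum>k<N. a k * \<Psi> k j x)" for j x
  have \<psi>_C1: "C1_supported_in \<Omega> (\<psi> j)" for j
    unfolding \<psi>_def by (intro C1_supported_linear_combination C1) auto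
  have grad_\<psi>: "grad (\<psi> j) x $ i = (\<Sum>k<N. a k * grad (\<Psi> k j) x $ i)" for i j x
    unfolding \<psi>_def by (subst C1_supported_linear_combination(2)[OF _ C1]) (auto simp: sum_component)
  show thesis
  proof (rule that[OF \<psi>_C1])
    show "L2_tendsto M \<psi> (\<lambda>x. \<Sum>k<N. a k * \<phi> k x)"
      unfolding \<psi>_def by (intro L2_tendsto_sum L2_tendsto_cmult \<Psi>)
    have norm_eq: "(LINT x|M. (norm (grad (\<psi> j) x))\<^sup>2) = (\<Sum>i\<in>UNIV. LINT x|M. (grad (\<psi> j) x $ i)\<^sup>2)" for j
      unfolding square_norm_vec
      by (intro Bochner_Integration.integral_sum sq_integrable_square sqC1 \<psi>_C1)
    have "(\<lambda>j. LINT x|M. (norm (grad (\<psi> j) x))\<^sup>2)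
        \<longlonglongrightarrow> (\<Sum>i\<in>UNIV. LINT x|M. (\<Sum>k<N. a k * G k x $ i)\<^sup>2)"
      unfolding norm_eq unfolding grad_\<psi>
      by (intro tendsto_sum L2_tendsto_integral_square L2_tendsto_sum L2_tendsto_cmult \<Psi>)
    also have "(\<Sum>i\<in>UNIV. LINT x|M. (\<Sum>k<N. a k * G k x $ i)\<^sup>2) =
        (\<Sum>i\<in>UNIV. \<Sum>k<N. \<Sum>l<N. a k * a l * (LINT x|M. G k x $ i * G l x $ i))"
      by (intro sum.cong refl integral_square_sum Gsq)
    also have "\<dots> = (\<Sum>k<N. \<Sum>l<N. a k * a l * (\<Sum>i\<in>UNIV. LINT x|M. G k x $ i * G l x $ i))"
      by (subst sum.swap, intro sum.cong refl, subst sum.swap) (simp add: sum_distrib_left)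
    also have "\<dots> = (\<Sum>k<N. ev k * (a k)\<^sup>2)"
      by (simp add: GG if_distrib power2_eq_square mult.commute mult.left_commute cong: if_cong)
    finally show "(\<lambda>j. LINT x|M. (norm (grad (\<psi> j) x))\<^sup>2) \<longlonglongrightarrow> (\<Sum>k<N. ev k * (a k)\<^sup>2)" .
  qed
qed

section \<open>Unboundedness of the eigenvalues by translating a small ball\<close>

lemma nn_integral_square_domain:
  assumes "sq_integrable M g"
  shows "(\<integral>\<^sup>+x. ennreal ((g x)\<^sup>2) * indicator \<Omega> x \<partial>lborel) = ennreal (LINT x|M. (g x)\<^sup>2)"
  unfolding nn_integral_domain[OF open_domain bounded_domain, symmetric]
  by (intro nn_integral_eq_integral sq_integrable_square assms) simp

text \<open>For x in the ball, 1 is the sum of \<open>1 - \<psi> x\<close>,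
  \<open>\<psi> (x + h)\<close> and \<open>\<psi> x - \<psi> (x + h)\<close>, so 1 is at most three
  times the sum of their squares. Integrated over the ball, the first two squares are errors of
  \<open>\<psi>\<close> against the indicator on disjoint parts of \<Omega>, and the third is
  controlled by the translation estimate.\<close>

lemma ball_measure_le:
  fixes \<psi> :: "real^'n \<Rightarrow> real" and h :: "real^'n"
  assumes C1: "C1_supported_in \<Omega> \<psi>" and r: "0 < r" "norm h = 2 * r" and ball: "ball x0 (3 * r) \<subseteq> \<Omega>"
  shows "measure lborel (ball x0 r) \<le> 3 * (LINT x|M. (\<psi> x - indicator (ball x0 r) x)\<^sup>2)
    + 3 * (norm h)\<^sup>2 * (LINT x|M. (norm (grad \<psi> x))\<^sup>2)"
proof -
  define B where "B = ball x0 r"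
  have B\<Omega>: "B \<subseteq> \<Omega>" using ball r(1) subset_ball[of r "3 * r" x0] by (auto simp: B_def)
  \<comment> \<open>A shift of length \<open>2 * r\<close> moves the ball of radius r off itself but
    keeps it within the ball of radius \<open>3 * r\<close>.\<close>
  have shift: "x + h \<in> \<Omega> - B" if "x \<in> B" for x
  proof -
    have "dist x0 x < r" using that by (simp add: B_def)
    moreover have "dist x (x + h) = 2 * r" using r(2) by (simp add: dist_norm)
    ultimately have "dist x0 (x + h) < 3 * r" "r < dist x0 (x + h)"
      using dist_triangle[of x0 "x + h" x] dist_triangle[of x "x + h" x0]
      by (auto simp: dist_commute)
    then show ?thesis using ball by (auto simp: B_def)
  qed
  have [measurable]: "B \<in> sets borel" by (simp add: B_def)
  have [measurable]: "\<psi> \<in> borel_measurable borel"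
    by (rule borel_measurable_continuous_onI[OF C1_supported_continuous[OF C1]])
  have [measurable]: "\<Omega> \<in> sets borel" using open_domain by simp
  have sq_ind: "sq_integrable M (indicator B)"
    by (rule sq_integrable_bounded[OF open_domain bounded_domain, of _ 1]) (auto split: split_indicator)
  note sq = sq_integrable_C1[OF open_domain bounded_domain C1]
  define q where "q x = (\<psi> x - indicator B x)\<^sup>2" for x
  have q_meas [measurable]: "q \<in> borel_measurable borel" unfolding q_def by measurable
  define D where "D = (\<integral>\<^sup>+x. ennreal ((\<psi> (x + h) - \<psi> x)\<^sup>2) \<partial>lborel)"
  have pw: "indicator B x \<le> 3 * (ennreal (q x) * indicator B x) +
      (3 * (ennreal (q (x + h)) * indicator (\<Omega> - B) (x + h)) + 3 * ennreal ((\<psi> (x + h) - \<psi> x)\<^sup>2))" for x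
  proof (cases "x \<in> B")
    case True
    define u v where "u = 1 - \<psi> x" "v = \<psi> (x + h)"
    have "1 \<le> 3 * (\<psi> x - 1)\<^sup>2 + (3 * v\<^sup>2 + 3 * (v - \<psi> x)\<^sup>2)"
    proof -
      \<comment> \<open>The three squared pairwise differences add up to three times the sum of the
        squares minus the square of the sum.\<close>
      have "0 \<le> (u - v)\<^sup>2 + (u - (\<psi> x - v))\<^sup>2 + (v - (\<psi> x - v))\<^sup>2" by simp
      moreover have "u + v + (\<psi> x - v) = 1" by (simp add: u_v_def)
      then have "(u + v + (\<psi> x - v))\<^sup>2 = 1" by simp
      ultimately have "1 \<le> 3 * u\<^sup>2 + 3 * v\<^sup>2 + 3 * (\<psi> x - v)\<^sup>2"
        by (simp only: power2_eq_square) (simp add: algebra_simps)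
      then show ?thesis by (simp add: u_v_def power2_commute)
    qed
    then have "ennreal 1 \<le> ennreal (3 * (\<psi> x - 1)\<^sup>2 + (3 * v\<^sup>2 + 3 * (v - \<psi> x)\<^sup>2))"
      by (rule ennreal_leI)
    also have "\<dots> = 3 * ennreal ((\<psi> x - 1)\<^sup>2) + (3 * ennreal (v\<^sup>2) + 3 * ennreal ((v - \<psi> x)\<^sup>2))"
      by (simp add: ennreal_plus ennreal_mult)
    finally show ?thesis using True shift[OF True] by (simp add: q_def u_v_def)
  qed auto
  have "emeasure lborel B = (\<integral>\<^sup>+x. indicator B x \<partial>lborel)" by simp
  also have "\<dots> \<le> (\<integral>\<^sup>+x. 3 * (ennreal (q x) * indicator B x) +
      (3 * (ennreal (q (x + h)) * indicator (\<Omega> - B) (x + h)) + 3 * ennreal ((\<psi> (x + h) - \<psi> x)\<^sup>2)) \<partial>lborel)"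
    by (intro nn_integral_mono pw)
  also have "\<dots> = 3 * (\<integral>\<^sup>+x. ennreal (q x) * indicator B x \<partial>lborel) +
      (3 * (\<integral>\<^sup>+x. ennreal (q (x + h)) * indicator (\<Omega> - B) (x + h) \<partial>lborel) + 3 * D)"
    unfolding D_def by (subst nn_integral_add; measurable?)+ (simp add: nn_integral_cmult nn_integral_add)
  also have "(\<integral>\<^sup>+x. ennreal (q (x + h)) * indicator (\<Omega> - B) (x + h) \<partial>lborel) =
      (\<integral>\<^sup>+x. ennreal (q x) * indicator (\<Omega> - B) x \<partial>distr lborel borel ((+) h))"
    by (subst nn_integral_distr) (auto simp: add.commute)
  also have "\<dots> = (\<integral>\<^sup>+x. ennreal (q x) * indicator (\<Omega> - B) x \<partial>lborel)"
    by (simp add: lborel_distr_plus)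
  also have "3 * (\<integral>\<^sup>+x. ennreal (q x) * indicator B x \<partial>lborel) +
      (3 * (\<integral>\<^sup>+x. ennreal (q x) * indicator (\<Omega> - B) x \<partial>lborel) + 3 * D)
      = 3 * (\<integral>\<^sup>+x. ennreal (q x) * indicator B x + ennreal (q x) * indicator (\<Omega> - B) x \<partial>lborel) + 3 * D"
    by (subst nn_integral_add) (auto simp: distrib_left add.assoc)
  also have "(\<integral>\<^sup>+x. ennreal (q x) * indicator B x + ennreal (q x) * indicator (\<Omega> - B) x \<partial>lborel)
      = (\<integral>\<^sup>+x. ennreal (q x) * indicator \<Omega> x \<partial>lborel)"
    using B\<Omega> by (intro nn_integral_cong) (auto split: split_indicator)
  also have "\<dots> = ennreal (LINT x|M. q x)"
    unfolding q_def by (intro nn_integral_square_domain sq_integrable_diff sq sq_ind)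
  finally have main: "emeasure lborel B \<le> 3 * ennreal (LINT x|M. q x) + 3 * D" .
  \<comment> \<open>The gradient vanishes off \<Omega>, so its integral over the whole space is the
    one over \<Omega>.\<close>
  have "(\<integral>\<^sup>+x. ennreal ((norm (grad \<psi> x))\<^sup>2) \<partial>lborel) = (\<integral>\<^sup>+x. ennreal ((norm (grad \<psi> x))\<^sup>2) * indicator \<Omega> x \<partial>lborel)"
    using C1 by (intro nn_integral_cong) (auto simp: C1_supported_in_def split: split_indicator)
  also have "\<dots> = ennreal (LINT x|M. (norm (grad \<psi> x))\<^sup>2)"
    using C1 by (intro nn_integral_square_domain sq_integrable_continuous[OF open_domain bounded_domain])
      (auto simp: C1_supported_in_def intro!: continuous_intros)
  finally have "D \<le> ennreal ((norm h)\<^sup>2) * ennreal (LINT x|M. (norm (grad \<psi> x))\<^sup>2)"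
    using translation_estimate[OF C1, of h] by (simp add: D_def)
  then have "emeasure lborel B \<le> 3 * ennreal (LINT x|M. q x)
      + 3 * (ennreal ((norm h)\<^sup>2) * ennreal (LINT x|M. (norm (grad \<psi> x))\<^sup>2))"
    by (intro order_trans[OF main] add_left_mono mult_left_mono) auto
  also have "\<dots> = ennreal (3 * (LINT x|M. q x) + 3 * (norm h)\<^sup>2 * (LINT x|M. (norm (grad \<psi> x))\<^sup>2))"
    by (simp add: ennreal_plus ennreal_mult q_def mult.assoc)
  finally have "measure lborel B \<le> 3 * (LINT x|M. q x) + 3 * (norm h)\<^sup>2 * (LINT x|M. (norm (grad \<psi> x))\<^sup>2)"
    unfolding measure_def by (intro enn2real_leI) (auto simp: q_def)
  then show ?thesis by (simp add: B_def q_def)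
qed

text \<open>Under a common bound C, the ball estimate applied to a C1 approximation of the indicator
  of a ball of measure \<open>\<mu> > 0\<close> gives
  \<open>\<mu> \<le> 3/8 * \<mu> + 1/2 * \<mu>\<close>.\<close>

lemma eigenvalues_unbounded: "\<exists>k. C < ev k"
proof (rule ccontr)
  assume "\<nexists>k. C < ev k"
  then have ev_le: "ev k \<le> C" for k by (simp add: not_less)
  with ev_pos[of 0] have C: "0 < C" by (meson less_le_trans)
  obtain x0 where "x0 \<in> \<Omega>" using nonempty_domain by blast
  then obtain \<rho> where \<rho>: "0 < \<rho>" "ball x0 \<rho> \<subseteq> \<Omega>" using open_domain open_contains_ball by blast
  \<comment> \<open>The first bound keeps the ball of radius \<open>3 * r\<close> inside \<Omega>;
    the second makes the gradient term, with \<open>(norm h)^2 = 4 * r^2\<close>, at most half of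
    \<open>\<mu>\<close>.\<close>
  define r where "r = min (\<rho> / 3) (1 / (24 * (C + 1)))"
  have r: "0 < r" "3 * r \<le> \<rho>" "r \<le> 1 / (24 * (C + 1))"
    using \<rho>(1) C by (auto simp: r_def)
  have "r \<le> 1" using r(3) by (rule order_trans) (use C in simp)
  then have "r\<^sup>2 \<le> 1 / (24 * (C + 1))"
    using r(1,3) mult_left_le[of r r] unfolding power2_eq_square by linarith
  then have r2: "12 * r\<^sup>2 * (C + 1) \<le> 1 / 2" using C by (simp add: field_simps)
  have ball: "ball x0 (3 * r) \<subseteq> \<Omega>" using \<rho>(2) r(2) subset_ball[of "3 * r" \<rho> x0] by auto
  define B \<mu> where "B = ball x0 r" "\<mu> = measure lborel B"
  have \<mu>: "0 < \<mu>" using r(1) by (simp add: B_\<mu>_def content_ball_pos)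
  have B\<Omega>: "B \<subseteq> \<Omega>" using ball r(1) subset_ball[of r "3 * r" x0] by (auto simp: B_\<mu>_def)
  have sq_ind: "sq_integrable M (indicator B)"
    by (rule sq_integrable_bounded[OF open_domain bounded_domain, of _ 1])
      (auto simp: B_\<mu>_def intro!: borel_measurable_indicator split: split_indicator)
  have norm_ind: "(LINT x|M. (indicator B x)\<^sup>2) = \<mu>"
  proof -
    have "ennreal (LINT x|M. (indicator B x)\<^sup>2) = (\<integral>\<^sup>+x. ennreal ((indicator B x)\<^sup>2) * indicator \<Omega> x \<partial>lborel)"
      by (rule nn_integral_square_domain[OF sq_ind, symmetric])
    also have "\<dots> = (\<integral>\<^sup>+x. indicator B x \<partial>lborel)"
      using B\<Omega> by (intro nn_integral_cong) (auto split: split_indicator)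
    also have "\<dots> = emeasure lborel B" by (simp add: B_\<mu>_def)
    also have "\<dots> = ennreal \<mu>"
      using emeasure_bounded_finite[of B] by (simp add: B_\<mu>_def emeasure_eq_ennreal_measure)
    finally show ?thesis using \<mu> by simp
  qed
  define S where "S N x = (\<Sum>k<N. fourier_coeff (indicator B) k * \<phi> k x)" for N x
  have S: "L2_tendsto M S (indicator B)"
    unfolding S_def by (rule expansion[OF sq_ind])
  have "\<forall>\<^sub>F N in sequentially. (LINT x|M. (S N x - indicator B x)\<^sup>2) < \<mu> / 32"
    using \<mu> by (intro order_tendstoD(2)[OF L2_tendstoD(3)[OF S]]) simp
  \<comment> \<open>Two errors below \<open>\<mu> / 32\<close>, this one and that of
    \<open>\<psi> j\<close> against \<open>S N\<close>, combine to less than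
    \<open>\<mu> / 8\<close>, since the square of a sum is at most twice the sum of the
    squares.\<close>
  then obtain N where N: "(LINT x|M. (S N x - indicator B x)\<^sup>2) < \<mu> / 32"
    by (auto simp: eventually_sequentially)
  obtain \<psi> where \<psi>: "\<And>j. C1_supported_in \<Omega> (\<psi> j)" "L2_tendsto M \<psi> (S N)"
    "(\<lambda>j. LINT x|M. (norm (grad (\<psi> j) x))\<^sup>2) \<longlonglongrightarrow> (\<Sum>k<N. ev k * (fourier_coeff (indicator B) k)\<^sup>2)"
    using combination_approximation[where N = N and a = "fourier_coeff (indicator B)"] unfolding S_def by blast
  \<comment> \<open>Bessel's inequality bounds the limiting gradient energy by
    \<open>C * \<mu>\<close>; enlarging C to \<open>C + 1\<close> makes the bound strict, so that it
    holds for all large j.\<close>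
  have "(\<Sum>k<N. ev k * (fourier_coeff (indicator B) k)\<^sup>2) \<le> (\<Sum>k<N. C * (fourier_coeff (indicator B) k)\<^sup>2)"
    by (intro sum_mono mult_right_mono ev_le) auto
  also have "\<dots> = C * (\<Sum>k<N. (fourier_coeff (indicator B) k)\<^sup>2)" by (simp add: sum_distrib_left)
  also have "\<dots> \<le> C * \<mu>"
    using Parseval[OF sq_ind] C unfolding norm_ind
    by (intro mult_left_mono) (auto simp: sums_iff intro!: sum_le_suminf)
  also have "\<dots> < (C + 1) * \<mu>" using \<mu> by (simp add: algebra_simps)
  finally have "\<forall>\<^sub>F j in sequentially. (LINT x|M. (norm (grad (\<psi> j) x))\<^sup>2) < (C + 1) * \<mu>"
    by (intro order_tendstoD(2)[OF \<psi>(3)])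
  moreover have "\<forall>\<^sub>F j in sequentially. (LINT x|M. (\<psi> j x - S N x)\<^sup>2) < \<mu> / 32"
    using \<mu> by (intro order_tendstoD(2)[OF L2_tendstoD(3)[OF \<psi>(2)]]) simp
  ultimately have "\<forall>\<^sub>F j in sequentially. (LINT x|M. (norm (grad (\<psi> j) x))\<^sup>2) < (C + 1) * \<mu> \<and>
      (LINT x|M. (\<psi> j x - S N x)\<^sup>2) < \<mu> / 32"
    by eventually_elim simp
  then obtain j where j: "(LINT x|M. (norm (grad (\<psi> j) x))\<^sup>2) < (C + 1) * \<mu>"
    "(LINT x|M. (\<psi> j x - S N x)\<^sup>2) < \<mu> / 32"
    by (auto simp: eventually_sequentially)
  have eq: "\<psi> j x - indicator B x = (\<psi> j x - S N x) + (S N x - indicator B x)" for x by simp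
  have close: "(LINT x|M. (\<psi> j x - indicator B x)\<^sup>2) < \<mu> / 8"
    using integral_square_add_le[OF sq_integrable_diff[OF L2_tendstoD(1,2)[OF \<psi>(2)]]
        sq_integrable_diff[OF L2_tendstoD(1,2)[OF S]], of j N] N j(2)
    unfolding eq[symmetric] by simp
  \<comment> \<open>Only the length of \<open>h\<close> matters; the coordinate direction is
    arbitrary.\<close>
  define h :: "real^'n" where "h = (2 * r) *\<^sub>R axis undefined 1"
  have h: "norm h = 2 * r" using r(1) by (simp add: h_def norm_axis_1)
  have "\<mu> \<le> 3 * (LINT x|M. (\<psi> j x - indicator B x)\<^sup>2) + 3 * (norm h)\<^sup>2 * (LINT x|M. (norm (grad (\<psi> j) x))\<^sup>2)"
    using ball_measure_le[OF \<psi>(1) r(1) h ball] by (simp add: B_\<mu>_def)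
  also have "\<dots> \<le> 3 * (\<mu> / 8) + 3 * (norm h)\<^sup>2 * ((C + 1) * \<mu>)"
    using close j(1) by (intro add_mono mult_left_mono) auto
  also have "\<dots> = 3 / 8 * \<mu> + (12 * r\<^sup>2 * (C + 1)) * \<mu>"
    by (simp add: h power_mult_distrib)
  also have "\<dots> \<le> 3 / 8 * \<mu> + 1 / 2 * \<mu>"
    using r2 \<mu> by (intro add_left_mono mult_right_mono) auto
  finally show False using \<mu> by simp
qed

lemma eigenvalues_at_top: "filterlim ev at_top sequentially"
proof (rule filterlim_at_top[THEN iffD2], rule allI)
  fix C
  obtain k where "C < ev k" using eigenvalues_unbounded by blast
  then show "\<forall>\<^sub>F n in sequentially. C \<le> ev n"
    using incseqD[OF ev_mono] by (force simp: eventually_sequentially intro: less_imp_le less_le_trans)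
qed

end

subsection \<open>Minimising the energy\<close>

text \<open>The first-order condition at a minimum. For \<open>d\<close> positive and greater than
  \<open>B\<close>, the choice \<open>t = - A / d\<close> gives \<open>(A / d)^2 * (B - d)\<close>,
  which is negative unless A is 0.\<close>

lemma zero_if_quadratic_nonneg:
  fixes A B :: real
  assumes "\<And>t. 0 \<le> t * A + t\<^sup>2 * B"
  shows "A = 0"
proof (rule ccontr)
  assume "A \<noteq> 0"
  define d where "d = \<bar>B\<bar> + 1"
  have d: "0 < d" "B < d" by (auto simp: d_def)
  have "(- A / d) * A + (- A / d)\<^sup>2 * B = (A / d)\<^sup>2 * (B - d)"
    using d(1) by (simp add: field_simps power2_eq_square)
  also have "\<dots> < 0" using \<open>A \<noteq> 0\<close> d by (intro mult_pos_neg) auto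
  finally show False using assms[of "- A / d"] by simp
qed

text \<open>The squared positive part is convex with derivative \<open>2 * pos_part a\<close> at a,
  so it lies above its tangents.\<close>

lemma pos_part_square_add_ge: "(pos_part a)\<^sup>2 + 2 * (pos_part a * b) \<le> (pos_part (a + b))\<^sup>2"
proof (cases "0 \<le> a")
  case True
  show ?thesis
  proof (cases "0 \<le> a + b")
    case True
    then show ?thesis using \<open>0 \<le> a\<close> by (simp add: pos_part_def power2_eq_square algebra_simps)
  next
    case False
    then have "a * (a + 2 * b) \<le> 0" using True by (intro mult_nonneg_nonpos) auto
    then show ?thesis using True False by (simp add: pos_part_def power2_eq_square algebra_simps)
  qed
qed (simp add: pos_part_def)

text \<open>The derivative of the squared positive part is Lipschitz with constant 2, so it exceeds
  its tangent at a by at most \<open>b^2\<close>.\<close>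

lemma pos_part_square_add_le: "(pos_part (a + b))\<^sup>2 \<le> (pos_part a)\<^sup>2 + 2 * (pos_part a * b) + b\<^sup>2"
proof (cases "0 \<le> a")
  case True
  have "0 \<le> (a + b)\<^sup>2" by simp
  then show ?thesis using True by (auto simp: pos_part_def max_def power2_eq_square algebra_simps)
next
  case False
  show ?thesis
  proof (cases "0 \<le> a + b")
    case True
    then have "(a + b)\<^sup>2 \<le> b\<^sup>2" using False by (intro power_mono) auto
    then show ?thesis using True False by (simp add: pos_part_def)
  qed (use False in \<open>simp add: pos_part_def\<close>)
qed

text \<open>One of y and -y is some \<open>z \<ge> 0\<close>. If \<open>\<gamma> \<le> z\<close>,
  the bound for z is half of the square of \<open>z - 2 * \<gamma>\<close> being nonnegative;
  otherwise its left side is at most 0. Both signs appear so that the sign of an eigenfunction need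
  not be known.\<close>

lemma pos_part_two_sided_ge:
  assumes "0 < \<gamma>"
  shows "y\<^sup>2 / 2 - \<gamma>\<^sup>2 \<le> (pos_part (y - \<gamma>))\<^sup>2 + (pos_part (- y - \<gamma>))\<^sup>2"
proof -
  have *: "z\<^sup>2 / 2 - \<gamma>\<^sup>2 \<le> (pos_part (z - \<gamma>))\<^sup>2" if "0 \<le> z" for z
  proof (cases "\<gamma> \<le> z")
    case True
    have "0 \<le> (z - 2 * \<gamma>)\<^sup>2" by simp
    then have "z\<^sup>2 / 2 - \<gamma>\<^sup>2 \<le> (z - \<gamma>)\<^sup>2" by (simp add: power2_eq_square algebra_simps)
    then show ?thesis using True by (simp add: pos_part_def)
  next
    case False
    then have "z\<^sup>2 \<le> \<gamma>\<^sup>2" using that by (intro power_mono) auto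
    then have "z\<^sup>2 / 2 - \<gamma>\<^sup>2 \<le> 0" using zero_le_power2[of z] by linarith
    then show ?thesis using zero_le_power2 order_trans by blast
  qed
  show ?thesis
  proof (cases "0 \<le> y")
    case True
    from *[OF this] show ?thesis by (simp add: add_increasing2)
  next
    case False
    with *[of "- y"] show ?thesis by (simp add: add_increasing)
  qed
qed

section \<open>The energy: lower semicontinuity and compactness of sublevel sets\<close>

context eigensystem
begin

lemma fourier_coeff_cmult: "fourier_coeff (\<lambda>x. a * f x) k = a * fourier_coeff f k"
  by (simp add: fourier_coeff_eq mult.assoc)

lemma fourier_coeff_add:
  assumes "sq_integrable M f" "sq_integrable M g"
  shows "fourier_coeff (\<lambda>x. f x + g x) k = fourier_coeff f k + fourier_coeff g k"
  using sq_integrable_mult[OF assms(1) eigenfunction_sq_integrable, of k]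
    sq_integrable_mult[OF assms(2) eigenfunction_sq_integrable, of k]
  by (simp add: fourier_coeff_eq distrib_right)

lemma fourier_coeff_diff:
  assumes "sq_integrable M f" "sq_integrable M g"
  shows "fourier_coeff (\<lambda>x. f x - g x) k = fourier_coeff f k - fourier_coeff g k"
  using fourier_coeff_add[OF assms(1) sq_integrable_cmult[OF assms(2)], of "-1" k]
  by (simp add: fourier_coeff_cmult[of "-1", simplified])

lemma fourier_coeff_eigenfunction: "fourier_coeff (\<phi> j) k = (if j = k then 1 else 0)"
  by (simp add: fourier_coeff_eq orthonormal)

lemma fourier_coeff_tendsto:
  "L2_tendsto M F f \<Longrightarrow> (\<lambda>j. fourier_coeff (F j) k) \<longlonglongrightarrow> fourier_coeff f k"
  unfolding fourier_coeff_eq by (intro L2_tendsto_integral_mult eigenfunction_sq_integrable)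

text \<open>The quadratic form of the spectral operator. The infinite sum carries meaning only for
  \<open>f\<close> in \<open>energy_space\<close>, where it converges.\<close>

definition energy :: "real \<Rightarrow> (real^'n \<Rightarrow> real) \<Rightarrow> real" where
  "energy s f = (\<Sum>k. ev k powr s * (fourier_coeff f k)\<^sup>2)"

lemma energy_space_iff:
  "f \<in> energy_space \<Omega> ev \<phi> s \<longleftrightarrow>
    sq_integrable M f \<and> summable (\<lambda>k. ev k powr s * (fourier_coeff f k)\<^sup>2)"
  by (simp add: energy_space_def L2_iff)

lemma energy_sums:
  "f \<in> energy_space \<Omega> ev \<phi> s \<Longrightarrow> (\<lambda>k. ev k powr s * (fourier_coeff f k)\<^sup>2) sums energy s f"
  by (simp add: energy_space_iff energy_def summable_sums)

lemma energy_nonneg: "f \<in> energy_space \<Omega> ev \<phi> s \<Longrightarrow> 0 \<le> energy s f"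
  by (auto simp: energy_space_iff energy_def intro!: suminf_nonneg)

lemma energy_partial_le:
  "f \<in> energy_space \<Omega> ev \<phi> s \<Longrightarrow> (\<Sum>k\<in>K. ev k powr s * (fourier_coeff f k)\<^sup>2) \<le> energy s f"
  \<comment> \<open>For infinite \<open>K\<close> the sum is 0 by default, and the energy is
    nonnegative.\<close>
  by (cases "finite K") (auto simp: energy_space_iff energy_def energy_nonneg intro!: sum_le_suminf suminf_nonneg)

text \<open>Each coefficient is continuous in mean square, so every partial sum for \<open>v\<close>
  is a limit of partial sums bounded by the energies of \<open>u j\<close>, hence at most m.\<close>

lemma energy_lower_semicontinuous:
  assumes u: "L2_tendsto M u v" and E: "\<And>j. u j \<in> energy_space \<Omega> ev \<phi> s"
    and m: "(\<lambda>j. energy s (u j)) \<longlonglongrightarrow> m"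
  shows "v \<in> energy_space \<Omega> ev \<phi> s" "energy s v \<le> m"
proof -
  have le: "(\<Sum>k<N. ev k powr s * (fourier_coeff v k)\<^sup>2) \<le> m" for N
  proof (rule LIMSEQ_le[OF _ m])
    show "(\<lambda>j. \<Sum>k<N. ev k powr s * (fourier_coeff (u j) k)\<^sup>2)
        \<longlonglongrightarrow> (\<Sum>k<N. ev k powr s * (fourier_coeff v k)\<^sup>2)"
      by (intro tendsto_intros fourier_coeff_tendsto u)
  qed (use energy_partial_le[OF E] in blast)
  have "summable (\<lambda>k. ev k powr s * (fourier_coeff v k)\<^sup>2)"
    by (rule summableI_nonneg_bounded[where x = m]) (auto intro: le)
  then show "v \<in> energy_space \<Omega> ev \<phi> s" "energy s v \<le> m"
    using L2_tendstoD(2)[OF u] le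
    by (auto simp: energy_space_iff energy_def intro!: suminf_le_const)
qed

text \<open>Compact embedding of the energy space. A diagonal subsequence makes every coefficient
  converge. Since the eigenvalues tend to infinity, the energy bound makes the tails of the
  coefficient series uniformly small, so the subsequence is Cauchy and completeness applies.\<close>

lemma bounded_energy_subsequence:
  assumes s: "0 < s" and E: "\<And>j. u j \<in> energy_space \<Omega> ev \<phi> s" "\<And>j. energy s (u j) \<le> C"
  obtains r v where "strict_mono (r :: nat \<Rightarrow> nat)" "L2_tendsto M (\<lambda>j. u (r j)) v"
proof -
  have sq: "sq_integrable M (u j)" for j using E(1) by (simp add: energy_space_iff)
  have ev_powr_mono: "ev i powr s \<le> ev k powr s" if "i \<le> k" for i k
    using that s ev_pos[of i] incseqD[OF ev_mono] by (intro powr_mono2) auto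
  have coeff_bound: "norm (fourier_coeff (u j) k) \<le> sqrt (C / ev 0 powr s)" for j k
  proof -
    have "ev 0 powr s * (fourier_coeff (u j) k)\<^sup>2 \<le> ev k powr s * (fourier_coeff (u j) k)\<^sup>2"
      by (intro mult_right_mono ev_powr_mono) auto
    also have "\<dots> \<le> C" using energy_partial_le[OF E(1), where K = "{k}"] E(2) by (force intro: order_trans)
    finally have "(fourier_coeff (u j) k)\<^sup>2 \<le> C / ev 0 powr s"
      using ev0_pos by (simp add: field_simps)
    then show ?thesis by (simp add: real_le_rsqrt)
  qed
  obtain r :: "nat \<Rightarrow> nat" where r: "strict_mono r"
    and lim: "\<And>k. k \<in> UNIV \<Longrightarrow> \<exists>l. (\<lambda>j. fourier_coeff (u (r j)) k) \<longlonglongrightarrow> l"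
    by (rule function_convergent_subsequence[of UNIV "\<lambda>j k. fourier_coeff (u j) k",
          OF countableI_type coeff_bound]) (rule that)
  define l where "l k = lim (\<lambda>j. fourier_coeff (u (r j)) k)" for k
  have l: "(\<lambda>j. fourier_coeff (u (r j)) k) \<longlonglongrightarrow> l k" for k
    unfolding l_def using lim[OF UNIV_I, of k] unfolding convergent_def[symmetric] convergent_LIMSEQ_iff .
  have C: "0 \<le> C" by (rule order_trans[OF energy_nonneg[OF E(1)] E(2)])
  have "\<exists>N. \<forall>i\<ge>N. \<forall>j\<ge>N. (LINT x|M. (u (r i) x - u (r j) x)\<^sup>2) < e" if e: "0 < e" for e
  proof -
    \<comment> \<open>Chosen so that the tail bound \<open>4 * C / T\<close> is at most
      \<open>e / 2\<close>; \<open>C + 1\<close> keeps T positive when C is 0.\<close>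
    define T where "T = 8 * (C + 1) / e"
    have T: "0 < T" using C e by (simp add: T_def)
    have "\<forall>\<^sub>F k in sequentially. T powr (1 / s) \<le> ev k"
      using eigenvalues_at_top by (simp add: filterlim_at_top)
    then obtain K where K: "\<And>k. K \<le> k \<Longrightarrow> T powr (1 / s) \<le> ev k"
      by (auto simp: eventually_sequentially)
    have T_le: "T \<le> ev k powr s" if "K \<le> k" for k
    proof -
      have "T = (T powr (1 / s)) powr s" using T s by (simp add: powr_powr)
      also have "\<dots> \<le> ev k powr s" using K[OF that] s by (intro powr_mono2) auto
      finally show ?thesis .
    qed
    have "(\<lambda>i. \<Sum>k<K. (fourier_coeff (u (r i)) k - l k)\<^sup>2) \<longlonglongrightarrow> (\<Sum>k<K. (l k - l k)\<^sup>2)"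
      by (intro tendsto_intros l)
    then have "\<forall>\<^sub>F i in sequentially. (\<Sum>k<K. (fourier_coeff (u (r i)) k - l k)\<^sup>2) < e / 8"
      using e by (intro order_tendstoD(2)) auto
    \<comment> \<open>Comparing two indices through \<open>l\<close> doubles each error, so
      \<open>e / 8\<close> for both leaves \<open>e / 2\<close> for the first K
      coefficients.\<close>
    then obtain N where N: "\<And>i. N \<le> i \<Longrightarrow> (\<Sum>k<K. (fourier_coeff (u (r i)) k - l k)\<^sup>2) < e / 8"
      by (auto simp: eventually_sequentially)
    have "(LINT x|M. (u (r i) x - u (r j) x)\<^sup>2) < e" if ij: "N \<le> i" "N \<le> j" for i j
    proof -
      define a b where "a k = fourier_coeff (u (r i)) k" "b k = fourier_coeff (u (r j)) k" for k
      have diff_le: "(x - y)\<^sup>2 \<le> 2 * x\<^sup>2 + 2 * y\<^sup>2" for x y :: real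
        using zero_le_power2[of "x + y"] by (simp add: power2_sum power2_diff)
      have sums_diff: "(\<lambda>k. (a k - b k)\<^sup>2) sums (LINT x|M. (u (r i) x - u (r j) x)\<^sup>2)"
        using Parseval[OF sq_integrable_diff[OF sq[of "r i"] sq[of "r j"]]]
        by (simp add: fourier_coeff_diff[OF sq sq] a_b_def)
      have sums_bound: "(\<lambda>k. (if k \<in> {..<K} then (a k - b k)\<^sup>2 else 0) +
          (2 * (ev k powr s * (a k)\<^sup>2) + 2 * (ev k powr s * (b k)\<^sup>2)) / T)
          sums ((\<Sum>k<K. (a k - b k)\<^sup>2) + (2 * energy s (u (r i)) + 2 * energy s (u (r j))) / T)"
        unfolding a_b_def by (intro sums_add sums_divide sums_mult energy_sums E sums_If_finite_set) auto
      \<comment> \<open>Below K the first summand suffices; from K on, the weight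
        \<open>ev k powr s\<close> is at least T, which trades the squared difference for energy
        terms divided by T.\<close>
      have le_bound: "(a k - b k)\<^sup>2 \<le> (if k \<in> {..<K} then (a k - b k)\<^sup>2 else 0) +
          (2 * (ev k powr s * (a k)\<^sup>2) + 2 * (ev k powr s * (b k)\<^sup>2)) / T" for k
      proof (cases "k < K")
        case True
        then show ?thesis using T by simp
      next
        case False
        have "T * (a k - b k)\<^sup>2 \<le> ev k powr s * (2 * (a k)\<^sup>2 + 2 * (b k)\<^sup>2)"
          using False T by (intro mult_mono T_le diff_le) auto
        then show ?thesis using False T by (simp add: field_simps)
      qed
      have "(LINT x|M. (u (r i) x - u (r j) x)\<^sup>2) \<le>
          (\<Sum>k<K. (a k - b k)\<^sup>2) + (2 * energy s (u (r i)) + 2 * energy s (u (r j))) / T"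
        by (rule sums_le[OF le_bound sums_diff sums_bound])
      also have "\<dots> \<le> (\<Sum>k<K. (a k - b k)\<^sup>2) + 4 * C / T"
        using E(2)[of "r i"] E(2)[of "r j"] T by (intro add_left_mono divide_right_mono) auto
      also have "4 * C / T \<le> e / 2"
        using C e by (simp add: T_def field_simps)
      also have "(\<Sum>k<K. (a k - b k)\<^sup>2) \<le> (\<Sum>k<K. 2 * (a k - l k)\<^sup>2 + 2 * (b k - l k)\<^sup>2)"
      proof (intro sum_mono)
        show "(a k - b k)\<^sup>2 \<le> 2 * (a k - l k)\<^sup>2 + 2 * (b k - l k)\<^sup>2" for k
          using diff_le[of "a k - l k" "b k - l k"] by simp
      qed
      also have "\<dots> = 2 * (\<Sum>k<K. (a k - l k)\<^sup>2) + 2 * (\<Sum>k<K. (b k - l k)\<^sup>2)"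
        by (simp add: sum.distrib sum_distrib_left)
      also have "\<dots> < 2 * (e / 8) + 2 * (e / 8)"
        using N[OF ij(1)] N[OF ij(2)] by (simp add: a_b_def)
      finally show ?thesis by simp
    qed
    then show ?thesis by blast
  qed
  from L2_complete[of "\<lambda>j. u (r j)", OF sq this]
  obtain v where "L2_tendsto M (\<lambda>j. u (r j)) v" by blast
  with r show thesis by (rule that)
qed

section \<open>The excess functional and the existence of a constrained minimiser\<close>

definition excess :: "real \<Rightarrow> (real^'n \<Rightarrow> real) \<Rightarrow> real" where
  "excess \<gamma> f = (LINT x|M. (pos_part (f x - \<gamma>))\<^sup>2)"

lemma pos_part_sq_integrable:
  assumes "0 < \<gamma>" "sq_integrable M f"
  shows "sq_integrable M (\<lambda>x. pos_part (f x - \<gamma>))"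
proof (rule sq_integrable_bound[OF assms(2)])
  show "(\<lambda>x. pos_part (f x - \<gamma>)) \<in> borel_measurable M"
    using sq_integrable_measurable[OF assms(2)] unfolding pos_part_def by measurable
  show "\<bar>pos_part (f x - \<gamma>)\<bar> \<le> \<bar>f x\<bar>" for x using assms(1) by (auto simp: pos_part_def)
qed

text \<open>The pointwise tangent inequalities, integrated. The lower bound shows that variations
  stay admissible; together the bounds give continuity.\<close>

lemma excess_add_bounds:
  assumes \<gamma>: "0 < \<gamma>" and f: "sq_integrable M f" and g: "sq_integrable M g"
  shows "excess \<gamma> f + 2 * (LINT x|M. pos_part (f x - \<gamma>) * g x) \<le> excess \<gamma> (\<lambda>x. f x + g x)"
    and "excess \<gamma> (\<lambda>x. f x + g x) \<le>
      excess \<gamma> f + 2 * (LINT x|M. pos_part (f x - \<gamma>) * g x) + (LINT x|M. (g x)\<^sup>2)"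
proof -
  have eq: "f x + g x - \<gamma> = (f x - \<gamma>) + g x" for x by simp
  note int = sq_integrable_square[OF pos_part_sq_integrable[OF \<gamma> f]]
    sq_integrable_square[OF pos_part_sq_integrable[OF \<gamma> sq_integrable_add[OF f g]], unfolded eq]
    sq_integrable_mult[OF pos_part_sq_integrable[OF \<gamma> f] g] sq_integrable_square[OF g]
  have "(LINT x|M. (pos_part (f x - \<gamma>))\<^sup>2 + 2 * (pos_part (f x - \<gamma>) * g x))
      \<le> (LINT x|M. (pos_part ((f x - \<gamma>) + g x))\<^sup>2)"
    using int by (intro integral_mono pos_part_square_add_ge) auto
  then show "excess \<gamma> f + 2 * (LINT x|M. pos_part (f x - \<gamma>) * g x) \<le> excess \<gamma> (\<lambda>x. f x + g x)"
    using int by (simp add: excess_def eq)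
  have "(LINT x|M. (pos_part ((f x - \<gamma>) + g x))\<^sup>2)
      \<le> (LINT x|M. (pos_part (f x - \<gamma>))\<^sup>2 + 2 * (pos_part (f x - \<gamma>) * g x) + (g x)\<^sup>2)"
    using int by (intro integral_mono pos_part_square_add_le) auto
  then show "excess \<gamma> (\<lambda>x. f x + g x) \<le>
      excess \<gamma> f + 2 * (LINT x|M. pos_part (f x - \<gamma>) * g x) + (LINT x|M. (g x)\<^sup>2)"
    using int by (simp add: excess_def eq)
qed

text \<open>With the increment \<open>F j - f\<close>, both tangent bounds converge to the excess of
  \<open>f\<close>: the linear term by weak convergence, the quadratic term by assumption.\<close>

lemma excess_tendsto:
  assumes \<gamma>: "0 < \<gamma>" and F: "L2_tendsto M F f"
  shows "(\<lambda>j. excess \<gamma> (F j)) \<longlonglongrightarrow> excess \<gamma> f"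
proof -
  note sq = L2_tendstoD(1,2)[OF F]
  let ?w = "\<lambda>x. pos_part (f x - \<gamma>)"
  note w = pos_part_sq_integrable[OF \<gamma> sq(2)]
  define lin where "lin j = (LINT x|M. ?w x * (F j x - f x))" for j
  have "lin j = (LINT x|M. F j x * ?w x) - (LINT x|M. f x * ?w x)" for j
    using sq_integrable_mult[OF sq(1) w, of j] sq_integrable_mult[OF sq(2) w]
    by (simp add: lin_def algebra_simps)
  moreover have "(\<lambda>j. (LINT x|M. F j x * ?w x) - (LINT x|M. f x * ?w x)) \<longlonglongrightarrow> 0"
    by (intro LIM_zero L2_tendsto_integral_mult F w)
  ultimately have lin: "lin \<longlonglongrightarrow> 0" by presburger
  note bounds = excess_add_bounds[OF \<gamma> sq(2) sq_integrable_diff[OF sq], of _, simplified]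
  show ?thesis
  proof (rule tendsto_sandwich)
    show "\<forall>\<^sub>F j in sequentially. excess \<gamma> f + 2 * lin j \<le> excess \<gamma> (F j)"
      using bounds(1) by (simp add: lin_def)
    show "\<forall>\<^sub>F j in sequentially. excess \<gamma> (F j) \<le> excess \<gamma> f + 2 * lin j + (LINT x|M. (F j x - f x)\<^sup>2)"
      using bounds(2) by (simp add: lin_def)
    show "(\<lambda>j. excess \<gamma> f + 2 * lin j) \<longlonglongrightarrow> excess \<gamma> f"
      using lin by (auto intro!: tendsto_eq_intros)
    show "(\<lambda>j. excess \<gamma> f + 2 * lin j + (LINT x|M. (F j x - f x)\<^sup>2)) \<longlonglongrightarrow> excess \<gamma> f"
      using lin L2_tendstoD(3)[OF F] by (auto intro!: tendsto_eq_intros)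
  qed
qed

text \<open>The constraint set is nonempty: for large t the excesses of t and -t times the first
  eigenfunction add up to at least \<open>2 * c\<close>, so one of them reaches c.\<close>

lemma excess_unbounded:
  assumes \<gamma>: "0 < \<gamma>" and c: "0 < c"
  shows "\<exists>v \<in> energy_space \<Omega> ev \<phi> s. c \<le> excess \<gamma> v"
proof -
  \<comment> \<open>Solves
    \<open>t^2 / 2 - \<gamma>^2 * measure M (space M) = 2 * c\<close>.\<close>
  define t where "t = sqrt (4 * c + 2 * \<gamma>\<^sup>2 * measure M (space M))"
  have t2: "t\<^sup>2 = 4 * c + 2 * \<gamma>\<^sup>2 * measure M (space M)" using c by (simp add: t_def)
  have sq: "sq_integrable M (\<lambda>x. a * \<phi> 0 x)" for a
    by (intro sq_integrable_cmult eigenfunction_sq_integrable)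
  have in_space: "(\<lambda>x. a * \<phi> 0 x) \<in> energy_space \<Omega> ev \<phi> s" for a
    unfolding energy_space_iff fourier_coeff_cmult fourier_coeff_eigenfunction
    by (auto intro!: sq summable_finite[of "{0}"] split: if_splits)
  have int: "integrable M (\<lambda>x. (pos_part (a * \<phi> 0 x - \<gamma>))\<^sup>2)" for a
    by (intro sq_integrable_square pos_part_sq_integrable \<gamma> sq)
  have "2 * c = t\<^sup>2 / 2 * (LINT x|M. \<phi> 0 x * \<phi> 0 x) - (LINT x|M. \<gamma>\<^sup>2)"
    by (simp add: orthonormal t2 add_divide_distrib)
  also have "\<dots> = (LINT x|M. t\<^sup>2 / 2 * (\<phi> 0 x * \<phi> 0 x) - \<gamma>\<^sup>2)"
    using sq_integrable_mult[OF eigenfunction_sq_integrable eigenfunction_sq_integrable, of 0 0]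
    by (subst Bochner_Integration.integral_diff) auto
  also have "\<dots> \<le> (LINT x|M. (pos_part (t * \<phi> 0 x - \<gamma>))\<^sup>2 + (pos_part (- t * \<phi> 0 x - \<gamma>))\<^sup>2)"
  proof (intro integral_mono Bochner_Integration.integrable_add int)
    show "integrable M (\<lambda>x. t\<^sup>2 / 2 * (\<phi> 0 x * \<phi> 0 x) - \<gamma>\<^sup>2)"
      using sq_integrable_mult[OF eigenfunction_sq_integrable eigenfunction_sq_integrable, of 0 0] by simp
    show "t\<^sup>2 / 2 * (\<phi> 0 x * \<phi> 0 x) - \<gamma>\<^sup>2
        \<le> (pos_part (t * \<phi> 0 x - \<gamma>))\<^sup>2 + (pos_part (- t * \<phi> 0 x - \<gamma>))\<^sup>2" for x
      using pos_part_two_sided_ge[OF \<gamma>, of "t * \<phi> 0 x"]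
      by (simp add: power_mult_distrib power2_eq_square[of "\<phi> 0 x"])
  qed
  also have "\<dots> = excess \<gamma> (\<lambda>x. t * \<phi> 0 x) + excess \<gamma> (\<lambda>x. - t * \<phi> 0 x)"
    unfolding excess_def by (intro Bochner_Integration.integral_add int)
  finally have "c \<le> excess \<gamma> (\<lambda>x. t * \<phi> 0 x) \<or> c \<le> excess \<gamma> (\<lambda>x. - t * \<phi> 0 x)" by linarith
  then show ?thesis using in_space by blast
qed

text \<open>The direct method: a minimising sequence has bounded energy, hence a subsequence
  converging in mean square. Lower semicontinuity of the energy and continuity of the excess carry
  minimality and the constraint over to the limit.\<close>

lemma energy_minimiser_exists:
  assumes s: "0 < s" and \<gamma>: "0 < \<gamma>" and c: "0 < c"
  obtains u where "u \<in> energy_space \<Omega> ev \<phi> s" "c \<le> excess \<gamma> u"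
    "\<And>v. v \<in> energy_space \<Omega> ev \<phi> s \<Longrightarrow> c \<le> excess \<gamma> v \<Longrightarrow> energy s u \<le> energy s v"
proof -
  define A where "A = {v \<in> energy_space \<Omega> ev \<phi> s. c \<le> excess \<gamma> v}"
  define m where "m = Inf (energy s ` A)"
  have ne: "energy s ` A \<noteq> {}" using excess_unbounded[OF \<gamma> c] by (auto simp: A_def)
  have bdd: "bdd_below (energy s ` A)"
    by (rule bdd_belowI[of _ 0]) (auto simp: A_def energy_nonneg)
  have m_le: "m \<le> energy s v" if "v \<in> A" for v
    unfolding m_def using that bdd by (intro cInf_lower) auto
  have "\<exists>v\<in>A. energy s v < m + 1 / Suc n" for n
    using cInf_lessD[OF ne, of "m + 1 / Suc n"] by (auto simp: m_def)
  then obtain u where u: "\<And>n. u n \<in> A" "\<And>n. energy s (u n) < m + 1 / Suc n" by metis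
  have lim: "(\<lambda>n. energy s (u n)) \<longlonglongrightarrow> m"
  proof (rule tendsto_sandwich[where f = "\<lambda>_. m"])
    show "(\<lambda>n. m + 1 / Suc n) \<longlonglongrightarrow> m"
      using tendsto_add[OF tendsto_const LIMSEQ_Suc[OF lim_1_over_n], of m] by simp
  qed (use u m_le in \<open>auto intro!: always_eventually less_imp_le\<close>)
  have "energy s (u n) \<le> m + 1" for n
  proof -
    have "1 / real (Suc n) \<le> 1" by simp
    then show ?thesis using u(2)[of n] by linarith
  qed
  then obtain r v where r: "strict_mono r" and v: "L2_tendsto M (\<lambda>n. u (r n)) v"
    using bounded_energy_subsequence[OF s, of u] u(1) unfolding A_def by blast
  have lim': "(\<lambda>n. energy s (u (r n))) \<longlonglongrightarrow> m"
    using LIMSEQ_subseq_LIMSEQ[OF lim r] by (simp add: o_def)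
  have E: "u (r n) \<in> energy_space \<Omega> ev \<phi> s" "c \<le> excess \<gamma> (u (r n))" for n
    using u(1) by (auto simp: A_def)
  note lsc = energy_lower_semicontinuous[OF v E(1) lim']
  have "c \<le> excess \<gamma> v"
    using excess_tendsto[OF \<gamma> v] E(2) by (intro LIMSEQ_le_const) auto
  then show thesis
    using lsc m_le by (intro that[of v]) (auto simp: A_def intro: order_trans)
qed

end

section \<open>First variation at the minimiser\<close>

theorem lemma3p2:
  fixes \<Omega> :: "(real^'n::finite) set"
    and ev :: "nat \<Rightarrow> real" and \<phi> :: "nat \<Rightarrow> real^'n \<Rightarrow> real"
    and s c \<gamma> :: real
  assumes "smooth_bounded_domain \<Omega>"
    and "dirichlet_eigensystem \<Omega> ev \<phi>"
    and "0 < s" and "s < 1"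
    and "0 < c" and "0 < \<gamma>"
  shows "\<exists>l>0. \<exists>u\<in>energy_space \<Omega> ev \<phi> s.
           spectral_frac_laplacian \<Omega> ev \<phi> s u = eigen_coeff \<Omega> \<phi> (\<lambda>x. l * pos_part (u x - \<gamma>)) \<and>
           (LINT x|lebesgue_on \<Omega>. (pos_part (u x - \<gamma>))\<^sup>2) = c"
proof -
  interpret eigensystem \<Omega> ev \<phi> using assms by unfold_locales
  note \<gamma> = \<open>0 < \<gamma>\<close>
  obtain u where u: "u \<in> energy_space \<Omega> ev \<phi> s" "c \<le> excess \<gamma> u"
    and min: "\<And>v. v \<in> energy_space \<Omega> ev \<phi> s \<Longrightarrow> c \<le> excess \<gamma> v \<Longrightarrow> energy s u \<le> energy s v"
    using energy_minimiser_exists[OF \<open>0 < s\<close> \<gamma> \<open>0 < c\<close>] by blast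
  define E w where "E = energy s u" "w x = pos_part (u x - \<gamma>)" for x
  \<comment> \<open>The multiplier will be \<open>E / p\<close>: pairing the equation with
    \<open>u\<close> gives E on the left and the multiplier times p on the right.\<close>
  define p where "p = (LINT x|M. w x * u x)"
  have usq: "sq_integrable M u" using u(1) by (simp add: energy_space_iff)
  have wsq: "sq_integrable M w" unfolding E_w_def by (rule pos_part_sq_integrable[OF \<gamma> usq])
  have sq_scaled: "sq_integrable M (\<lambda>x. a * u x)" for a by (rule sq_integrable_cmult[OF usq])
  \<comment> \<open>Where \<open>w\<close> is positive it equals \<open>u - \<gamma>\<close>, which
    is less than \<open>u\<close>; hence the square of \<open>w\<close> is at most
    \<open>w * u\<close>.\<close>
  have "excess \<gamma> u \<le> p"
    unfolding excess_def p_def E_w_def(2)[symmetric]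
    using sq_integrable_square[OF wsq] sq_integrable_mult[OF wsq usq] \<gamma>
    by (intro integral_mono) (auto simp: E_w_def pos_part_def max_def power2_eq_square intro!: mult_left_mono)
  with u(2) \<open>0 < c\<close> have p: "0 < p" by simp
  \<comment> \<open>Zero energy would make all coefficients vanish, so \<open>u\<close> would have
    norm 0 by Parseval, and Cauchy-Schwarz would force \<open>p = 0\<close>.\<close>
  have E: "0 < E"
  proof (rule ccontr)
    assume "\<not> 0 < E"
    with energy_nonneg[OF u(1)] have "energy s u = 0" by (simp add: E_w_def)
    then have "ev k powr s * (fourier_coeff u k)\<^sup>2 \<le> 0" for k
      using energy_partial_le[OF u(1), of "{k}"] by simp
    then have "fourier_coeff u k = 0" for k
      using ev_pos[of k] by (metis linorder_not_less mult_pos_pos powr_gt_zero zero_less_power2 less_irrefl)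
    then have "(LINT x|M. (u x)\<^sup>2) = 0" using Parseval[OF usq] by (simp add: sums_iff)
    then have "p\<^sup>2 \<le> 0" using integral_mult_square_le[OF wsq usq] by (simp add: p_def)
    then show False using p by simp
  qed
  have excess_u: "excess \<gamma> u = c"
  proof (rule ccontr)
    assume "excess \<gamma> u \<noteq> c"
    with u(2) have gap: "0 < excess \<gamma> u - c" by simp
    \<comment> \<open>By the tangent bound, scaling \<open>u\<close> by \<open>1 - d\<close> lowers
      the excess by at most \<open>2 * d * p\<close>, which is no more than the gap;
      \<open>d \<le> 1 / 2\<close> keeps the factor strictly between 0 and 1, so the energy
      drops.\<close>
    define d where "d = min (1 / 2) ((excess \<gamma> u - c) / (2 * p))"
    have d: "0 < d" "d \<le> 1 / 2" "d \<le> (excess \<gamma> u - c) / (2 * p)"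
      using gap p by (auto simp: d_def)
    have "2 * (d * p) \<le> excess \<gamma> u - c" using d(3) p by (simp add: field_simps)
    moreover have "excess \<gamma> u - 2 * (d * p) \<le> excess \<gamma> (\<lambda>x. u x + - d * u x)"
      using excess_add_bounds(1)[OF \<gamma> usq sq_scaled[of "- d"]]
      by (simp add: p_def E_w_def mult.left_commute)
    moreover have "(\<lambda>x. u x + - d * u x) = (\<lambda>x. (1 - d) * u x)" by (simp add: algebra_simps)
    ultimately have "c \<le> excess \<gamma> (\<lambda>x. (1 - d) * u x)" by simp
    moreover have sums: "(\<lambda>k. ev k powr s * (fourier_coeff (\<lambda>x. (1 - d) * u x) k)\<^sup>2) sums ((1 - d)\<^sup>2 * E)"
      using sums_mult[OF energy_sums[OF u(1)], of "(1 - d)\<^sup>2"]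
      by (simp add: fourier_coeff_cmult power_mult_distrib E_w_def mult.left_commute)
    ultimately have "E \<le> (1 - d)\<^sup>2 * E"
      using min[of "\<lambda>x. (1 - d) * u x"] sq_scaled by (auto simp: E_w_def energy_space_iff energy_def sums_iff)
    then have "1 \<le> (1 - d)\<^sup>2" using E by simp
    moreover have "(1 - d)\<^sup>2 < 1" using d by (simp add: power_less_one_iff abs_square_less_1)
    ultimately show False by simp
  qed
  have equation: "ev k powr s * fourier_coeff u k = E / p * fourier_coeff w k" for k
  proof -
    \<comment> \<open>This \<open>\<alpha>\<close> makes \<open>\<phi> k - \<alpha> u\<close>
      orthogonal to \<open>w\<close>. Convexity of the excess then keeps
      \<open>u + t (\<phi> k - \<alpha> u)\<close> admissible for every real t, and the polynomial
      below is its energy minus E.\<close>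
    define \<alpha> e b where "\<alpha> = fourier_coeff w k / p" "e = ev k powr s" "b = fourier_coeff u k"
    have "0 \<le> t * (2 * (e * b - \<alpha> * E)) + t\<^sup>2 * (\<alpha>\<^sup>2 * E - 2 * \<alpha> * e * b + e)" for t
    proof -
      \<comment> \<open>a variation orthogonal to \<open>w\<close>\<close>
      define g where "g x = t * \<phi> k x + (- t * \<alpha>) * u x" for x
      have gsq: "sq_integrable M g"
        unfolding g_def by (intro sq_integrable_add sq_scaled sq_integrable_cmult eigenfunction_sq_integrable)
      have "w x * g x = t * (w x * \<phi> k x) + (- t * \<alpha>) * (w x * u x)" for x
        by (simp add: g_def algebra_simps)
      then have "(LINT x|M. w x * g x) = t * fourier_coeff w k + (- t * \<alpha>) * p"
        using sq_integrable_mult[OF wsq eigenfunction_sq_integrable, of k] sq_integrable_mult[OF wsq usq]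
        by (simp add: p_def fourier_coeff_eq)
      also have "\<dots> = 0" using p by (simp add: \<alpha>_e_b_def)
      finally have feasible: "c \<le> excess \<gamma> (\<lambda>x. u x + g x)"
        using excess_add_bounds(1)[OF \<gamma> usq gsq] by (simp add: excess_u E_w_def)
      have fc: "fourier_coeff (\<lambda>x. u x + g x) i =
          (1 - t * \<alpha>) * fourier_coeff u i + (if i = k then t else 0)" for i
        unfolding fourier_coeff_add[OF usq gsq] unfolding g_def
        by (subst fourier_coeff_add[OF sq_integrable_cmult[OF eigenfunction_sq_integrable] sq_scaled])
          (simp only: fourier_coeff_cmult fourier_coeff_eigenfunction, simp add: algebra_simps)
      \<comment> \<open>The variation scales every coefficient by \<open>1 - t * \<alpha>\<close>
        and adds t only at index k, so its energy differs from the scaled energy in a single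
        term.\<close>
      have "(\<lambda>i. (1 - t * \<alpha>)\<^sup>2 * (ev i powr s * (fourier_coeff u i)\<^sup>2) +
          (if i = k then 2 * (1 - t * \<alpha>) * t * e * b + t\<^sup>2 * e else 0))
          sums ((1 - t * \<alpha>)\<^sup>2 * E + (2 * (1 - t * \<alpha>) * t * e * b + t\<^sup>2 * e))"
        unfolding E_w_def by (intro sums_add sums_mult energy_sums u sums_single)
      moreover have "(1 - t * \<alpha>)\<^sup>2 * (ev i powr s * (fourier_coeff u i)\<^sup>2) +
          (if i = k then 2 * (1 - t * \<alpha>) * t * e * b + t\<^sup>2 * e else 0)
          = ev i powr s * (fourier_coeff (\<lambda>x. u x + g x) i)\<^sup>2" for i
        unfolding fc by (simp add: \<alpha>_e_b_def(2,3) power2_eq_square algebra_simps)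
      ultimately have "(\<lambda>i. ev i powr s * (fourier_coeff (\<lambda>x. u x + g x) i)\<^sup>2)
          sums ((1 - t * \<alpha>)\<^sup>2 * E + (2 * (1 - t * \<alpha>) * t * e * b + t\<^sup>2 * e))" by simp
      then have "E \<le> (1 - t * \<alpha>)\<^sup>2 * E + (2 * (1 - t * \<alpha>) * t * e * b + t\<^sup>2 * e)"
        using min[OF _ feasible] sq_integrable_add[OF usq gsq]
        by (auto simp: E_w_def energy_space_iff energy_def sums_iff)
      then show ?thesis by (simp add: power2_eq_square algebra_simps)
    qed
    \<comment> \<open>Since t takes both signs, the coefficient of the linear term vanishes, and
      this is the equation for the coefficient at k.\<close>
    from zero_if_quadratic_nonneg[OF this] have "e * b = \<alpha> * E" by simp
    then show ?thesis by (simp add: \<alpha>_e_b_def mult.commute)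
  qed
  have "spectral_frac_laplacian \<Omega> ev \<phi> s u = eigen_coeff \<Omega> \<phi> (\<lambda>x. E / p * pos_part (u x - \<gamma>))"
    unfolding spectral_frac_laplacian_def equation
    unfolding E_w_def fourier_coeff_cmult ..
  then show ?thesis
    using E p u(1) excess_u by (intro exI[of _ "E / p"]) (auto simp: excess_def)
qed

end
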